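(* It is forced by every condition of $\mathbb{P}$ that the generic ultrafilter is not basically generated; that is, whenever $\mathcal{G}$ is a $\mathbf{V}$-generic filter for $\mathbb{P}$, in $\mathbf{V}[\mathcal{G}]$ the ultrafilter $\mathcal{G}$ on $\omega^2$ is not basically generated.
   Context: $\mathbf{V}$ is the ground model of ZFC. For $p\subseteq\omega^2$, $p(n)=\{m:\langle n,m\rangle\in p\}$. $\mathcal{F}$ is the Fréchet filter on $\omega$, and $\mathcal{F}^{\otimes 2}$ is the filter of all $X\subseteq\omega^2$ such that $X(n)$ is cofinite for all but finitely many $n$. The forcing $\mathbb{P}=(\mathcal{F}^{\otimes 2})^+$ consists of the sets $p\subseteq\omega^2$ such that $p(n)$ is infinite for infinitely many $n$, ordered by inclusion. A $\mathbf{V}$-generic filter for $\mathbb{P}$ is an ultrafilter on $\omega^2$ in the extension. A set $\mathcal{B}\subseteq\mathcal{U}$ is a base for an ultrafilter $\mathcal{U}$ if for every $a\in\mathcal{U}$ there is $b\in\mathcal{B}$ with $b\subseteq a$. An ultrafilter $\mathcal{U}$ on a countable set $S$ is basically generated if there is a base $\mathcal{B}\subseteq\mathcal{U}$ such that for every sequence $\langle b_n:n\in\omega\rangle$ of elements of $\mathcal{B}$ and every $b\in\mathcal{B}$, if $\langle b_n:n\in\omega\rangle$ converges to $b$ then there is an infinite $X\subseteq\omega$ such that $\bigcap_{n\in X}b_n\in\mathcal{U}$. Convergence is in the topology on $\mathcal{P}(S)$ obtained by identifying it with the product space $\{0,1\}^S$, $\{0,1\}$ discrete. *)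

theory Defs
  imports Complex_Main
begin

section \<open>Names\<close>

text \<open>
  The ground model is the universe of HOL. For a forcing notion \<open>'p\<close>, the names below are the
  usual \<open>'p\<close>-names, i.e. sets of pairs (name, condition), built hereditarily from sets of
  cardinality at most that of \<open>'k\<close>. HOL has no type of all names, so \<open>'k\<close> is a parameter that
  can be taken as large as desired. For infinite \<open>'k\<close> these are exactly the \<open>'p\<close>-names of hereditary
  cardinality at most that of \<open>'k\<close>; as soon as \<open>'k\<close> has at least as many elements as the forcing notion
  considered at the end, they include a name for every subset of \<open>\<omega>\<^sup>2\<close> and for every family of
  subsets of \<open>\<omega>\<^sup>2\<close> in the extension.
\<close>

datatype ('k, 'p) name = Name "'k \<Rightarrow> (('k, 'p) name \<times> 'p) option"

primrec elts :: "('k, 'p) name \<Rightarrow> (('k, 'p) name \<times> 'p) set" where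
  "elts (Name f) = ran f"

text \<open>
  Different values of type \<open>name\<close> may have the same elements. This is harmless since the
  forcing relation depends on \<open>elts\<close> only. The choice in \<open>mk_name\<close> is meaningful for sets of
  size at most \<open>'k\<close>, see \<open>elts_mk_name\<close>.
\<close>

definition mk_name :: "(('k, 'p) name \<times> 'p) set \<Rightarrow> ('k, 'p) name" where
  "mk_name A = (SOME \<tau>. elts \<tau> = A)"

lemma elts_mk_name:
  fixes e :: "'c \<Rightarrow> 'k" and f :: "'c \<Rightarrow> ('k, 'p) name \<times> 'p"
  assumes "inj_on e C"
  shows "elts (mk_name (f ` C)) = f ` C"
proof -
  define g where "g = (\<lambda>i. if i \<in> e ` C then Some (f (inv_into C e i)) else None)"
  have "ran g = f ` C"
    using assms unfolding g_def ran_def by (auto simp: image_iff split: if_splits) (metis inv_into_f_f)+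
  then have "elts (Name g) = f ` C" by simp
  then show ?thesis unfolding mk_name_def by (rule someI)
qed

definition name_rel :: "(('k, 'p) name \<times> ('k, 'p) name) set" where
  "name_rel = {(\<sigma>, \<tau>). \<exists>s. (\<sigma>, s) \<in> elts \<tau>}"

lemma wf_name_rel: "wf (name_rel :: (('k, 'p) name \<times> ('k, 'p) name) set)"
proof (rule wfUNIVI)
  fix P :: "('k, 'p) name \<Rightarrow> bool" and \<tau>
  assume step: "\<forall>x. (\<forall>y. (y, x) \<in> name_rel \<longrightarrow> P y) \<longrightarrow> P x"
  show "P \<tau>"
  proof (induction \<tau>)
    case (Name f)
    have "P y" if y: "(y, Name f) \<in> name_rel" for y
    proof -
      obtain s i where "f i = Some (y, s)"
        using y by (auto simp: name_rel_def ran_def)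
      then show ?thesis
        by (intro Name[of "f i" "(y, s)" y]) (auto intro: range_eqI[of _ _ i] simp: fsts.simps)
    qed
    then show ?case using step by blast
  qed
qed


section \<open>The forcing relation\<close>

text \<open>
  A sentence of the forcing language (with names as parameters) is represented by the predicate
  \<open>\<lambda>p. p \<tturnstile> \<phi>\<close> on conditions. The clauses for \<open>=\<close>, \<open>\<in>\<close>, \<open>\<and>\<close>, \<open>\<not>\<close>, \<open>\<exists>\<close> are those of the standard
  recursive definition inside the ground model; the other connectives are abbreviations in terms
  of these. Smaller conditions are stronger.
\<close>

type_synonym 'p sentence = "'p \<Rightarrow> bool"

definition dense_below :: "'p::order \<Rightarrow> ('p \<Rightarrow> bool) \<Rightarrow> bool" where
  "dense_below p D \<longleftrightarrow> (\<forall>q\<le>p. \<exists>r\<le>q. D r)"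

lemma dense_below_cong [fundef_cong]:
  "p = p' \<Longrightarrow> (\<And>r. D r = D' r) \<Longrightarrow> dense_below p D = dense_below p' D'"
  by (simp add: dense_below_def)

function fEq :: "('k, 'p::order) name \<Rightarrow> ('k, 'p) name \<Rightarrow> 'p sentence" where
  "fEq \<tau>1 \<tau>2 p \<longleftrightarrow>
     (\<forall>(\<sigma>, s)\<in>elts \<tau>1. dense_below p (\<lambda>q. q \<le> s \<longrightarrow> (\<exists>(\<pi>, t)\<in>elts \<tau>2. q \<le> t \<and> fEq \<sigma> \<pi> q))) \<and>
     (\<forall>(\<pi>, t)\<in>elts \<tau>2. dense_below p (\<lambda>q. q \<le> t \<longrightarrow> (\<exists>(\<sigma>, s)\<in>elts \<tau>1. q \<le> s \<and> fEq \<sigma> \<pi> q)))"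
  by pat_completeness auto
termination
proof (relation "inv_image name_rel (\<lambda>(\<tau>1, \<tau>2, p). \<tau>1)")
  show "wf (inv_image name_rel (\<lambda>(\<tau>1 :: ('k, 'p) name, \<tau>2 :: ('k, 'p) name, p :: 'p). \<tau>1))"
    by (rule wf_inv_image[OF wf_name_rel])
qed (auto simp: name_rel_def)

declare fEq.simps [simp del]

notation fEq (infix "\<^bold>=" 65)

definition fMem :: "('k, 'p::order) name \<Rightarrow> ('k, 'p) name \<Rightarrow> 'p sentence" (infix "\<^bold>\<in>" 65) where
  "(\<sigma> \<^bold>\<in> \<tau>) = (\<lambda>p. dense_below p (\<lambda>q. \<exists>(\<pi>, s)\<in>elts \<tau>. q \<le> s \<and> (\<pi> \<^bold>= \<sigma>) q))"

definition fAnd :: "'p::order sentence \<Rightarrow> 'p sentence \<Rightarrow> 'p sentence" (infixr "\<^bold>\<and>" 55) where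
  "(\<phi> \<^bold>\<and> \<psi>) = (\<lambda>p. \<phi> p \<and> \<psi> p)"

definition fNot :: "'p::order sentence \<Rightarrow> 'p sentence" ("\<^bold>\<not> _" [60] 60) where
  "(\<^bold>\<not> \<phi>) = (\<lambda>p. \<forall>q\<le>p. \<not> \<phi> q)"

definition fEx :: "(('k, 'p::order) name \<Rightarrow> 'p sentence) \<Rightarrow> 'p sentence" (binder "\<^bold>\<exists>" 51) where
  "fEx \<Phi> = (\<lambda>p. dense_below p (\<lambda>q. \<exists>\<tau>. \<Phi> \<tau> q))"

definition fOr :: "'p::order sentence \<Rightarrow> 'p sentence \<Rightarrow> 'p sentence" (infixr "\<^bold>\<or>" 54) where
  "(\<phi> \<^bold>\<or> \<psi>) = (\<^bold>\<not> (\<^bold>\<not> \<phi> \<^bold>\<and> \<^bold>\<not> \<psi>))"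

definition fImp :: "'p::order sentence \<Rightarrow> 'p sentence \<Rightarrow> 'p sentence" (infixr "\<^bold>\<longrightarrow>" 53) where
  "(\<phi> \<^bold>\<longrightarrow> \<psi>) = (\<^bold>\<not> (\<phi> \<^bold>\<and> \<^bold>\<not> \<psi>))"

definition fIff :: "'p::order sentence \<Rightarrow> 'p sentence \<Rightarrow> 'p sentence" (infix "\<^bold>\<longleftrightarrow>" 52) where
  "(\<phi> \<^bold>\<longleftrightarrow> \<psi>) = ((\<phi> \<^bold>\<longrightarrow> \<psi>) \<^bold>\<and> (\<psi> \<^bold>\<longrightarrow> \<phi>))"

definition fAll :: "(('k, 'p::order) name \<Rightarrow> 'p sentence) \<Rightarrow> 'p sentence" (binder "\<^bold>\<forall>" 51) where
  "fAll \<Phi> = (\<^bold>\<not> (\<^bold>\<exists>\<tau>. \<^bold>\<not> \<Phi> \<tau>))"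

definition fBex :: "('k, 'p::order) name \<Rightarrow> (('k, 'p) name \<Rightarrow> 'p sentence) \<Rightarrow> 'p sentence" where
  "fBex \<tau> \<Phi> = (\<^bold>\<exists>\<sigma>. \<sigma> \<^bold>\<in> \<tau> \<^bold>\<and> \<Phi> \<sigma>)"

definition fBall :: "('k, 'p::order) name \<Rightarrow> (('k, 'p) name \<Rightarrow> 'p sentence) \<Rightarrow> 'p sentence" where
  "fBall \<tau> \<Phi> = (\<^bold>\<forall>\<sigma>. \<sigma> \<^bold>\<in> \<tau> \<^bold>\<longrightarrow> \<Phi> \<sigma>)"

syntax
  "_fBex" :: "pttrn \<Rightarrow> 'a \<Rightarrow> 'b \<Rightarrow> 'b" ("(3\<^bold>\<exists>_\<^bold>\<in>_./ _)" [0, 66, 51] 51)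
  "_fBall" :: "pttrn \<Rightarrow> 'a \<Rightarrow> 'b \<Rightarrow> 'b" ("(3\<^bold>\<forall>_\<^bold>\<in>_./ _)" [0, 66, 51] 51)
translations
  "\<^bold>\<exists>x\<^bold>\<in>A. P" \<rightleftharpoons> "CONST fBex A (\<lambda>x. P)"
  "\<^bold>\<forall>x\<^bold>\<in>A. P" \<rightleftharpoons> "CONST fBall A (\<lambda>x. P)"

definition forces :: "'p::order \<Rightarrow> 'p sentence \<Rightarrow> bool" (infix "\<tturnstile>" 50) where
  "p \<tturnstile> \<phi> \<longleftrightarrow> \<phi> p"


section \<open>Canonical names for ground model sets\<close>

text \<open>Natural numbers are von Neumann numerals and pairs are Kuratowski pairs.\<close>

primrec nat_name :: "nat \<Rightarrow> ('k, 'p::order_top) name" where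
  "nat_name 0 = mk_name {}"
| "nat_name (Suc n) = mk_name (insert (nat_name n, top) (elts (nat_name n)))"

definition omega_name :: "('k, 'p::order_top) name" where
  "omega_name = mk_name ((\<lambda>n. (nat_name n, top)) ` UNIV)"

definition upair_name :: "('k, 'p::order_top) name \<Rightarrow> ('k, 'p) name \<Rightarrow> ('k, 'p) name" where
  "upair_name \<sigma> \<tau> = mk_name {(\<sigma>, top), (\<tau>, top)}"

definition pair_name :: "nat \<times> nat \<Rightarrow> ('k, 'p::order_top) name" where
  "pair_name z = upair_name (upair_name (nat_name (fst z)) (nat_name (fst z)))
                            (upair_name (nat_name (fst z)) (nat_name (snd z)))"

definition check_name :: "(nat \<times> nat) set \<Rightarrow> ('k, 'p::order_top) name" where
  "check_name A = mk_name ((\<lambda>z. (pair_name z, top)) ` A)"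


section \<open>Basically generated ultrafilters, in the forcing language\<close>

definition fSubset :: "('k, 'p::order) name \<Rightarrow> ('k, 'p) name \<Rightarrow> 'p sentence" (infix "\<^bold>\<subseteq>" 65) where
  "(a \<^bold>\<subseteq> b) = (\<^bold>\<forall>x\<^bold>\<in>a. x \<^bold>\<in> b)"

definition fIsUpair :: "('k, 'p::order) name \<Rightarrow> ('k, 'p) name \<Rightarrow> ('k, 'p) name \<Rightarrow> 'p sentence" where
  "fIsUpair z a b = (\<^bold>\<forall>x. x \<^bold>\<in> z \<^bold>\<longleftrightarrow> (x \<^bold>= a \<^bold>\<or> x \<^bold>= b))"

definition fIsPair :: "('k, 'p::order) name \<Rightarrow> ('k, 'p) name \<Rightarrow> ('k, 'p) name \<Rightarrow> 'p sentence" where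
  "fIsPair z a b = (\<^bold>\<exists>u. \<^bold>\<exists>v. fIsUpair u a a \<^bold>\<and> fIsUpair v a b \<^bold>\<and> fIsUpair z u v)"

definition fMapsto :: "('k, 'p::order) name \<Rightarrow> ('k, 'p) name \<Rightarrow> ('k, 'p) name \<Rightarrow> 'p sentence" where
  "fMapsto f x y = (\<^bold>\<exists>z\<^bold>\<in>f. fIsPair z x y)"

definition fFunction :: "('k, 'p::order) name \<Rightarrow> ('k, 'p) name \<Rightarrow> ('k, 'p) name \<Rightarrow> 'p sentence" where
  "fFunction f A B =
     ((\<^bold>\<forall>z\<^bold>\<in>f. \<^bold>\<exists>x\<^bold>\<in>A. \<^bold>\<exists>y\<^bold>\<in>B. fIsPair z x y) \<^bold>\<and>
      (\<^bold>\<forall>x\<^bold>\<in>A. \<^bold>\<exists>y\<^bold>\<in>B. fMapsto f x y \<^bold>\<and> (\<^bold>\<forall>y'. fMapsto f x y' \<^bold>\<longrightarrow> y' \<^bold>= y)))"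

definition fBijection :: "('k, 'p::order) name \<Rightarrow> ('k, 'p) name \<Rightarrow> ('k, 'p) name \<Rightarrow> 'p sentence" where
  "fBijection f A B =
     (fFunction f A B \<^bold>\<and>
      (\<^bold>\<forall>y\<^bold>\<in>B. \<^bold>\<exists>x\<^bold>\<in>A. fMapsto f x y \<^bold>\<and> (\<^bold>\<forall>x'. fMapsto f x' y \<^bold>\<longrightarrow> x' \<^bold>= x)))"

definition fFinite :: "('k, 'p::order_top) name \<Rightarrow> 'p sentence" where
  "fFinite F = (\<^bold>\<exists>n\<^bold>\<in>omega_name. \<^bold>\<exists>f. fBijection f n F)"

text \<open>
  Under the identification of the power set of \<open>S\<close> with the product space \<open>{0,1}\<^sup>S\<close>, the basic open
  neighbourhoods of \<open>a\<close> are the sets of all \<open>c \<subseteq> S\<close> that agree with \<open>a\<close> on a given finite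
  \<open>F \<subseteq> S\<close>.
\<close>

definition fOpen :: "('k, 'p::order_top) name \<Rightarrow> ('k, 'p) name \<Rightarrow> 'p sentence" where
  "fOpen S W =
     ((\<^bold>\<forall>a\<^bold>\<in>W. a \<^bold>\<subseteq> S) \<^bold>\<and>
      (\<^bold>\<forall>a\<^bold>\<in>W. \<^bold>\<exists>F. F \<^bold>\<subseteq> S \<^bold>\<and> fFinite F \<^bold>\<and>
         (\<^bold>\<forall>c. c \<^bold>\<subseteq> S \<^bold>\<and> (\<^bold>\<forall>x\<^bold>\<in>F. x \<^bold>\<in> c \<^bold>\<longleftrightarrow> x \<^bold>\<in> a) \<^bold>\<longrightarrow> c \<^bold>\<in> W)))"

definition fConverges :: "('k, 'p::order_top) name \<Rightarrow> ('k, 'p) name \<Rightarrow> ('k, 'p) name \<Rightarrow> 'p sentence" where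
  "fConverges S f b =
     (\<^bold>\<forall>W. fOpen S W \<^bold>\<and> b \<^bold>\<in> W \<^bold>\<longrightarrow>
        (\<^bold>\<exists>m\<^bold>\<in>omega_name. \<^bold>\<forall>n\<^bold>\<in>omega_name. (m \<^bold>= n \<^bold>\<or> m \<^bold>\<in> n) \<^bold>\<longrightarrow>
           (\<^bold>\<forall>c. fMapsto f n c \<^bold>\<longrightarrow> c \<^bold>\<in> W)))"

definition fBase :: "('k, 'p::order) name \<Rightarrow> ('k, 'p) name \<Rightarrow> 'p sentence" where
  "fBase B U = (B \<^bold>\<subseteq> U \<^bold>\<and> (\<^bold>\<forall>a\<^bold>\<in>U. \<^bold>\<exists>b\<^bold>\<in>B. b \<^bold>\<subseteq> a))"

text \<open>\<open>fIsInter c f X\<close>: \<open>c\<close> is the intersection of the sets \<open>f(n)\<close> for \<open>n \<in> X\<close>.\<close>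

definition fIsInter :: "('k, 'p::order) name \<Rightarrow> ('k, 'p) name \<Rightarrow> ('k, 'p) name \<Rightarrow> 'p sentence" where
  "fIsInter c f X = (\<^bold>\<forall>x. x \<^bold>\<in> c \<^bold>\<longleftrightarrow> (\<^bold>\<forall>n\<^bold>\<in>X. \<^bold>\<forall>a. fMapsto f n a \<^bold>\<longrightarrow> x \<^bold>\<in> a))"

text \<open>The property of an ultrafilter \<open>U\<close> on the countable set \<open>S\<close> of being basically generated.\<close>

definition fBasicallyGenerated :: "('k, 'p::order_top) name \<Rightarrow> ('k, 'p) name \<Rightarrow> 'p sentence" where
  "fBasicallyGenerated S U =
     (\<^bold>\<exists>B. fBase B U \<^bold>\<and>
        (\<^bold>\<forall>f. \<^bold>\<forall>b\<^bold>\<in>B. fFunction f omega_name B \<^bold>\<and> fConverges S f b \<^bold>\<longrightarrow>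
           (\<^bold>\<exists>X. X \<^bold>\<subseteq> omega_name \<^bold>\<and> \<^bold>\<not> fFinite X \<^bold>\<and> (\<^bold>\<exists>c. fIsInter c f X \<^bold>\<and> c \<^bold>\<in> U))))"


section \<open>The forcing notion and its generic ultrafilter\<close>

typedef cond = "{p :: (nat \<times> nat) set. infinite {n. infinite {m. (n, m) \<in> p}}}"
  morphisms cond_set Cond
  by (rule exI[of _ UNIV]) simp

instantiation cond :: order_top
begin

definition less_eq_cond :: "cond \<Rightarrow> cond \<Rightarrow> bool" where
  "p \<le> q \<longleftrightarrow> cond_set p \<subseteq> cond_set q"

definition less_cond :: "cond \<Rightarrow> cond \<Rightarrow> bool" where
  "p < q \<longleftrightarrow> cond_set p \<subset> cond_set q"

definition top_cond :: cond where
  "top = Cond UNIV"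

instance
  by standard (auto simp: less_eq_cond_def less_cond_def top_cond_def Cond_inverse cond_set_inject)

end

text \<open>The canonical name \<open>{(p\<^sup>\<or>, p) | p}\<close> of the generic filter.\<close>

definition generic_name :: "('k, cond) name" where
  "generic_name = mk_name ((\<lambda>p. (check_name (cond_set p), p)) ` UNIV)"

end

theory Submission
  imports Defs "HOL-Library.Countable_Set"
begin

text \<open>
  Let \<open>B\<close> be a name for a base of the generic ultrafilter. By fusion there are a condition \<open>d\<close>, a set
  \<open>b\<close> and sets \<open>c n\<close> such that \<open>d\<close> forces \<open>b\<close> and all \<open>c n\<close> into \<open>B\<close>, \<open>c n\<close> agrees with \<open>b\<close> on
  \<open>n \<times> n\<close>, and \<open>c n \<inter> d\<close> is finite in each column below \<open>n\<close>. To find them, enumerate all pairs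
  \<open>(s, n)\<close> with \<open>s\<close> finite. At each step either some \<open>c\<close> with \<open>c \<inter> n \<times> n = s\<close> is forced into \<open>B\<close>
  while infinitely much outside of \<open>c\<close> is kept in each of the finitely many columns \<open>K\<close> already
  promised, or, halving these columns, one ensures that no such \<open>c\<close> is a subset of \<open>d\<close>. Any
  \<open>b \<in> B\<close> with \<open>b \<subseteq> d\<close> then rules out the second alternative at every \<open>(b \<inter> n \<times> n, n)\<close>.

  So \<open>c n\<close> converges to \<open>b\<close> in \<open>B\<close>. If the intersection of the \<open>c n\<close> over an infinite \<open>X\<close> were
  generic, it would contain a condition below \<open>d\<close>; choose a column \<open>k\<close> where that condition is
  infinite and \<open>n \<in> X\<close> above \<open>k\<close> to contradict that \<open>c n \<inter> d\<close> is finite in column \<open>k\<close>.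

  Elements of the generic ultrafilter are, by the choice of its name, locally decided to be ground
  model sets, hence it is never needed that the forcing adds no new reals.
\<close>

section \<open>Regular sentences\<close>

text \<open>A \<open>sentence\<close> is an arbitrary predicate on conditions, so persistence to
  stronger conditions and truth by density are not automatic. This one equivalence yields both; the
  predicates satisfying it are the regular open subsets of the order.\<close>

definition regular :: "'p::order sentence \<Rightarrow> bool" where
  "regular \<phi> \<longleftrightarrow> (\<forall>p. \<phi> p \<longleftrightarrow> dense_below p \<phi>)"

lemma dense_belowI: "(\<And>q. q \<le> p \<Longrightarrow> \<exists>r\<le>q. D r) \<Longrightarrow> dense_below p D"
  by (simp add: dense_below_def)

lemma dense_belowE:
  assumes "dense_below p D" and "q \<le> p"
  obtains r where "r \<le> q" and "D r"
  using assms by (auto simp: dense_below_def)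

lemma dense_below_mono:
  assumes "dense_below p D" and "q \<le> p" and "\<And>r. r \<le> q \<Longrightarrow> D r \<Longrightarrow> E r"
  shows "dense_below q E"
  using assms unfolding dense_below_def by (meson order_trans)

lemma dense_below_dense_below [simp]: "dense_below p (\<lambda>q. dense_below q D) \<longleftrightarrow> dense_below p D"
  unfolding dense_below_def by (meson order_trans order_refl)

lemma regular_dense_below: "regular (\<lambda>p. dense_below p D)"
  by (simp add: regular_def)

lemma regularI_dense:
  assumes "regular \<phi>" and "\<And>q. q \<le> p \<Longrightarrow> \<exists>r\<le>q. \<phi> r"
  shows "\<phi> p"
  using assms unfolding regular_def dense_below_def by blast

lemma regular_mono: "regular \<phi> \<Longrightarrow> \<phi> p \<Longrightarrow> q \<le> p \<Longrightarrow> \<phi> q"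
  unfolding regular_def by (metis dense_below_mono)

lemma regular_fAnd: "regular \<phi> \<Longrightarrow> regular \<psi> \<Longrightarrow> regular (\<phi> \<^bold>\<and> \<psi>)"
proof -
  assume reg: "regular \<phi>" "regular \<psi>"
  have "\<phi> p \<and> \<psi> p" if "dense_below p (\<lambda>q. \<phi> q \<and> \<psi> q)" for p
    using reg that by (metis (no_types, lifting) dense_below_mono order_refl regular_def)
  moreover have "dense_below p (\<lambda>q. \<phi> q \<and> \<psi> q)" if "\<phi> p \<and> \<psi> p" for p
    using reg that unfolding dense_below_def by (meson order_refl regular_mono)
  ultimately show ?thesis
    unfolding regular_def fAnd_def by blast
qed

lemma regular_fNot: "regular \<phi> \<Longrightarrow> regular (\<^bold>\<not> \<phi>)"
proof -
  assume reg: "regular \<phi>"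
  have "(\<^bold>\<not> \<phi>) p" if "dense_below p (\<^bold>\<not> \<phi>)" for p
    using that reg unfolding fNot_def dense_below_def by (meson order_refl order_trans regular_mono)
  moreover have "dense_below p (\<^bold>\<not> \<phi>)" if "(\<^bold>\<not> \<phi>) p" for p
    using that unfolding fNot_def dense_below_def by (meson order_refl order_trans)
  ultimately show ?thesis
    unfolding regular_def by blast
qed

lemma regular_fEx: "regular (fEx \<Phi>)"
  by (simp add: fEx_def regular_dense_below)

lemma regular_fOr: "regular \<phi> \<Longrightarrow> regular \<psi> \<Longrightarrow> regular (\<phi> \<^bold>\<or> \<psi>)"
  by (simp add: fOr_def regular_fAnd regular_fNot)

lemma regular_fImp: "regular \<phi> \<Longrightarrow> regular \<psi> \<Longrightarrow> regular (\<phi> \<^bold>\<longrightarrow> \<psi>)"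
  by (simp add: fImp_def regular_fAnd regular_fNot)

lemma regular_fIff: "regular \<phi> \<Longrightarrow> regular \<psi> \<Longrightarrow> regular (\<phi> \<^bold>\<longleftrightarrow> \<psi>)"
  by (simp add: fIff_def regular_fAnd regular_fImp)

lemma regular_fAll: "regular (fAll \<Phi>)"
  by (simp add: fAll_def regular_fNot regular_fEx)

lemma regular_fMem: "regular (\<sigma> \<^bold>\<in> \<tau>)"
  by (simp add: fMem_def regular_dense_below)

text \<open>One unfolding of equality suffices, without induction on names: each conjunct is a
  density statement, and nested density collapses.\<close>

lemma regular_fEq: "regular (\<sigma> \<^bold>= \<tau>)"
proof -
  have "(\<sigma> \<^bold>= \<tau>) p \<longleftrightarrow> dense_below p (\<sigma> \<^bold>= \<tau>)" for p
  proof
    assume "(\<sigma> \<^bold>= \<tau>) p"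
    then have "(\<sigma> \<^bold>= \<tau>) q" if "q \<le> p" for q
      using that unfolding fEq.simps[of \<sigma> \<tau>] by (fast intro: dense_below_mono)
    then show "dense_below p (\<sigma> \<^bold>= \<tau>)"
      unfolding dense_below_def by blast
  next
    assume *: "dense_below p (\<sigma> \<^bold>= \<tau>)"
    have "dense_below p (\<lambda>q. q \<le> s \<longrightarrow> (\<exists>(\<pi>, t)\<in>elts \<tau>. q \<le> t \<and> (\<sigma>' \<^bold>= \<pi>) q))"
      if "(\<sigma>', s) \<in> elts \<sigma>" for \<sigma>' s
      using dense_below_mono[OF * order_refl, of "\<lambda>q. dense_below q (\<lambda>q. q \<le> s \<longrightarrow> (\<exists>(\<pi>, t)\<in>elts \<tau>. q \<le> t \<and> (\<sigma>' \<^bold>= \<pi>) q))"]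
        that unfolding fEq.simps[of \<sigma> \<tau>] by fastforce
    moreover have "dense_below p (\<lambda>q. q \<le> t \<longrightarrow> (\<exists>(\<sigma>', s)\<in>elts \<sigma>. q \<le> s \<and> (\<sigma>' \<^bold>= \<pi>) q))"
      if "(\<pi>, t) \<in> elts \<tau>" for \<pi> t
      using dense_below_mono[OF * order_refl, of "\<lambda>q. dense_below q (\<lambda>q. q \<le> t \<longrightarrow> (\<exists>(\<sigma>', s)\<in>elts \<sigma>. q \<le> s \<and> (\<sigma>' \<^bold>= \<pi>) q))"]
        that unfolding fEq.simps[of \<sigma> \<tau>] by fastforce
    ultimately show "(\<sigma> \<^bold>= \<tau>) p"
      unfolding fEq.simps[of \<sigma> \<tau>] by blast
  qed
  then show ?thesis by (simp add: regular_def)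
qed

lemma regular_fBex: "regular (fBex \<tau> \<Phi>)"
  by (simp add: fBex_def regular_fEx)

lemma regular_fBall: "regular (fBall \<tau> \<Phi>)"
  by (simp add: fBall_def regular_fAll)

lemmas regular_intros = regular_fAnd regular_fNot regular_fEx regular_fOr regular_fImp regular_fIff
  regular_fAll regular_fMem regular_fEq regular_fBex regular_fBall

section \<open>Connectives and quantifiers read pointwise on conditions\<close>

lemma fNot_iff: "(\<^bold>\<not> \<phi>) p \<longleftrightarrow> (\<forall>q\<le>p. \<not> \<phi> q)"
  by (simp add: fNot_def)

lemma fAnd_iff: "(\<phi> \<^bold>\<and> \<psi>) p \<longleftrightarrow> \<phi> p \<and> \<psi> p"
  by (simp add: fAnd_def)

lemma fEx_iff: "fEx \<Phi> p \<longleftrightarrow> dense_below p (\<lambda>q. \<exists>\<tau>. \<Phi> \<tau> q)"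
  by (simp add: fEx_def)

lemma fBex_iff: "fBex \<tau> \<Phi> p \<longleftrightarrow> dense_below p (\<lambda>q. \<exists>\<sigma>. (\<sigma> \<^bold>\<in> \<tau>) q \<and> \<Phi> \<sigma> q)"
  by (simp add: fBex_def fEx_iff fAnd_iff)

lemma fOr_iff:
  assumes "regular \<phi>" and "regular \<psi>"
  shows "(\<phi> \<^bold>\<or> \<psi>) p \<longleftrightarrow> dense_below p (\<lambda>q. \<phi> q \<or> \<psi> q)"
  using assms unfolding fOr_def fNot_iff fAnd_iff dense_below_def
  by (meson order_refl order_trans regular_mono)

text \<open>If \<open>q\<close> satisfies \<open>\<phi>\<close>, no extension of \<open>q\<close>
  may satisfy the negation of \<open>\<psi>\<close>. So \<open>\<psi>\<close> holds densely below
  \<open>q\<close>, and regularity brings it back to \<open>q\<close>.\<close>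

lemma fImp_iff:
  assumes "regular \<phi>" and "regular \<psi>"
  shows "(\<phi> \<^bold>\<longrightarrow> \<psi>) p \<longleftrightarrow> (\<forall>q\<le>p. \<phi> q \<longrightarrow> \<psi> q)"
proof
  assume imp: "(\<phi> \<^bold>\<longrightarrow> \<psi>) p"
  have "\<psi> q" if "q \<le> p" "\<phi> q" for q
  proof (rule regularI_dense[OF assms(2)])
    fix r assume "r \<le> q"
    then show "\<exists>s\<le>r. \<psi> s"
      using imp that regular_mono[OF assms(1)] unfolding fImp_def fNot_iff fAnd_iff
      by (meson order_trans)
  qed
  then show "\<forall>q\<le>p. \<phi> q \<longrightarrow> \<psi> q" by blast
qed (auto simp: fImp_def fNot_iff fAnd_iff)

lemma fIff_iff:
  assumes "regular \<phi>" and "regular \<psi>"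
  shows "(\<phi> \<^bold>\<longleftrightarrow> \<psi>) p \<longleftrightarrow> (\<forall>q\<le>p. \<phi> q \<longleftrightarrow> \<psi> q)"
  using assms by (auto simp: fIff_def fAnd_iff fImp_iff)

text \<open>Failure of density below \<open>q\<close> yields some \<open>r\<close> below which no
  negated instance holds. Hence every instance holds at some extension of \<open>r\<close>, and
  regularity of the instances finishes the argument.\<close>

lemma fAll_iff:
  assumes "\<And>\<tau>. regular (\<Phi> \<tau>)"
  shows "fAll \<Phi> p \<longleftrightarrow> (\<forall>\<tau>. \<Phi> \<tau> p)"
proof
  assume all: "fAll \<Phi> p"
  show "\<forall>\<tau>. \<Phi> \<tau> p"
  proof
    fix \<tau>
    show "\<Phi> \<tau> p"
    proof (rule regularI_dense[OF assms])
      fix q assume "q \<le> p"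
      then obtain r where "r \<le> q" "\<forall>s\<le>r. \<not> (\<exists>\<tau>. (\<^bold>\<not> \<Phi> \<tau>) s)"
        using all unfolding fAll_def fNot_iff[of "fEx _"] fEx_iff dense_below_def by blast
      then show "\<exists>r\<le>q. \<Phi> \<tau> r"
        unfolding fNot_iff by (meson order_refl order_trans)
    qed
  qed
next
  assume "\<forall>\<tau>. \<Phi> \<tau> p"
  then show "fAll \<Phi> p"
    using regular_mono[OF assms] unfolding fAll_def fNot_iff fEx_iff dense_below_def
    by (meson order_refl)
qed

lemma fBall_iff:
  assumes "\<And>\<sigma>. regular (\<Phi> \<sigma>)"
  shows "fBall \<tau> \<Phi> p \<longleftrightarrow> (\<forall>\<sigma>. \<forall>q\<le>p. (\<sigma> \<^bold>\<in> \<tau>) q \<longrightarrow> \<Phi> \<sigma> q)"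
  using assms by (simp add: fBall_def fAll_iff fImp_iff regular_intros)

lemmas forcing_iffs = fNot_iff fAnd_iff fEx_iff fBex_iff fOr_iff fImp_iff fIff_iff fAll_iff fBall_iff


section \<open>Equality and membership\<close>

lemma fEq_refl [simp]: "(\<tau> \<^bold>= \<tau>) p"
proof (induction \<tau> arbitrary: p rule: wf_induct_rule[OF wf_name_rel])
  case (1 \<tau>)
  have "(\<sigma> \<^bold>= \<sigma>) q" if "(\<sigma>, s) \<in> elts \<tau>" for \<sigma> s q
    using 1 that by (auto simp: name_rel_def)
  then show ?case
    unfolding fEq.simps[of \<tau>] dense_below_def by fast
qed

text \<open>Both conjuncts of \<open>fEq\<close> recurse with the element of the first name on the
  left, so symmetry is not syntactic. Induction swaps the inner equalities, after which the two
  conjuncts trade places.\<close>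

lemma fEq_commute: "(\<sigma> \<^bold>= \<tau>) p \<longleftrightarrow> (\<tau> \<^bold>= \<sigma>) p"
proof (induction \<sigma> arbitrary: \<tau> p rule: wf_induct_rule[OF wf_name_rel])
  case (1 \<sigma>)
  have IH: "(\<pi> \<^bold>= \<rho>) q \<longleftrightarrow> (\<rho> \<^bold>= \<pi>) q" if "(\<pi>, s) \<in> elts \<sigma>" for \<pi> s \<rho> q
    using 1 that by (auto simp: name_rel_def)
  have *: "(\<exists>(\<pi>, s)\<in>elts \<sigma>. q \<le> s \<and> (\<pi> \<^bold>= \<rho>) q) \<longleftrightarrow> (\<exists>(\<pi>, s)\<in>elts \<sigma>. q \<le> s \<and> (\<rho> \<^bold>= \<pi>) q)"
    for q \<rho>
    using IH by blast
  have **: "(\<forall>(\<pi>, s)\<in>elts \<sigma>. dense_below p (\<lambda>q. q \<le> s \<longrightarrow> (\<exists>(\<rho>, t)\<in>elts \<tau>. q \<le> t \<and> (\<pi> \<^bold>= \<rho>) q)))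
    \<longleftrightarrow> (\<forall>(\<pi>, s)\<in>elts \<sigma>. dense_below p (\<lambda>q. q \<le> s \<longrightarrow> (\<exists>(\<rho>, t)\<in>elts \<tau>. q \<le> t \<and> (\<rho> \<^bold>= \<pi>) q)))"
  proof (rule ball_cong[OF refl], clarify)
    fix \<pi> s assume "(\<pi>, s) \<in> elts \<sigma>"
    from IH[OF this] show "dense_below p (\<lambda>q. q \<le> s \<longrightarrow> (\<exists>(\<rho>, t)\<in>elts \<tau>. q \<le> t \<and> (\<pi> \<^bold>= \<rho>) q))
      \<longleftrightarrow> dense_below p (\<lambda>q. q \<le> s \<longrightarrow> (\<exists>(\<rho>, t)\<in>elts \<tau>. q \<le> t \<and> (\<rho> \<^bold>= \<pi>) q))"
      by simp
  qed
  show ?case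
    unfolding fEq.simps[of \<sigma> \<tau>] fEq.simps[of \<tau> \<sigma>] * ** by (rule conj_commute)
qed

lemma fEq_sym: "(\<sigma> \<^bold>= \<tau>) p \<Longrightarrow> (\<tau> \<^bold>= \<sigma>) p"
  by (simp add: fEq_commute)

lemmas fEq_mono = regular_mono[OF regular_fEq]
  and fMem_mono = regular_mono[OF regular_fMem]

lemma fEqE:
  assumes "(\<sigma> \<^bold>= \<tau>) p" and "(\<pi>, s) \<in> elts \<sigma>" and "q \<le> p" and "q \<le> s"
  obtains \<rho> t r where "(\<rho>, t) \<in> elts \<tau>" and "r \<le> q" and "r \<le> t" and "(\<pi> \<^bold>= \<rho>) r"
proof -
  have "dense_below p (\<lambda>q. q \<le> s \<longrightarrow> (\<exists>(\<rho>, t)\<in>elts \<tau>. q \<le> t \<and> (\<pi> \<^bold>= \<rho>) q))"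
    using assms(1,2) unfolding fEq.simps[of \<sigma> \<tau>] by fast
  then obtain r where r: "r \<le> q" "r \<le> s \<longrightarrow> (\<exists>(\<rho>, t)\<in>elts \<tau>. r \<le> t \<and> (\<pi> \<^bold>= \<rho>) r)"
    using assms(3) by (rule dense_belowE)
  moreover have "r \<le> s" using r(1) assms(4) by simp
  ultimately show ?thesis
    using that by blast
qed

text \<open>Where \<open>q\<close> is not below \<open>s\<close>, the implication in the density
  clause holds vacuously at \<open>q\<close> itself; so only conditions below \<open>s\<close> have
  to be treated.\<close>

lemma fEqI:
  assumes "\<And>\<pi> s q. (\<pi>, s) \<in> elts \<sigma> \<Longrightarrow> q \<le> p \<Longrightarrow> q \<le> s \<Longrightarrow> \<exists>(\<rho>, t)\<in>elts \<tau>. \<exists>r\<le>q. r \<le> t \<and> (\<pi> \<^bold>= \<rho>) r"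
    and "\<And>\<rho> t q. (\<rho>, t) \<in> elts \<tau> \<Longrightarrow> q \<le> p \<Longrightarrow> q \<le> t \<Longrightarrow> \<exists>(\<pi>, s)\<in>elts \<sigma>. \<exists>r\<le>q. r \<le> s \<and> (\<pi> \<^bold>= \<rho>) r"
  shows "(\<sigma> \<^bold>= \<tau>) p"
proof -
  have "\<exists>r\<le>q. r \<le> s \<longrightarrow> (\<exists>(\<rho>, t)\<in>elts \<tau>. r \<le> t \<and> (\<pi> \<^bold>= \<rho>) r)"
    if "(\<pi>, s) \<in> elts \<sigma>" "q \<le> p" for \<pi> s q
  proof (cases "q \<le> s")
    case True
    from assms(1)[OF that this] show ?thesis by blast
  qed blast
  moreover have "\<exists>r\<le>q. r \<le> t \<longrightarrow> (\<exists>(\<pi>, s)\<in>elts \<sigma>. r \<le> s \<and> (\<pi> \<^bold>= \<rho>) r)"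
    if "(\<rho>, t) \<in> elts \<tau>" "q \<le> p" for \<rho> t q
  proof (cases "q \<le> t")
    case True
    from assms(2)[OF that this] show ?thesis by blast
  qed blast
  ultimately show ?thesis
    unfolding fEq.simps[of \<sigma> \<tau>] dense_below_def by blast
qed

text \<open>Elements are chased through the middle name. The induction hypothesis covers elements of
  \<open>\<sigma>\<close> only, so the chase starting in \<open>\<upsilon>\<close> is reversed by
  symmetry before it is applied.\<close>

lemma fEq_trans: "(\<sigma> \<^bold>= \<tau>) p \<Longrightarrow> (\<tau> \<^bold>= \<upsilon>) p \<Longrightarrow> (\<sigma> \<^bold>= \<upsilon>) p"
proof (induction \<sigma> arbitrary: \<tau> \<upsilon> p rule: wf_induct_rule[OF wf_name_rel])
  case (1 \<sigma>)
  have IH: "(\<pi> \<^bold>= \<rho>) q \<Longrightarrow> (\<rho> \<^bold>= \<chi>) q \<Longrightarrow> (\<pi> \<^bold>= \<chi>) q" if "(\<pi>, s) \<in> elts \<sigma>" for \<pi> s \<rho> \<chi> q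
    using 1(1)[of \<pi> \<rho> q \<chi>] that by (auto simp: name_rel_def)
  show ?case
  proof (rule fEqI)
    fix \<pi> s q assume \<pi>: "(\<pi>, s) \<in> elts \<sigma>" "q \<le> p" "q \<le> s"
    obtain \<rho> t r where \<rho>: "(\<rho>, t) \<in> elts \<tau>" "r \<le> q" "r \<le> t" "(\<pi> \<^bold>= \<rho>) r"
      using fEqE[OF 1(2) \<pi>] .
    obtain \<chi> u r' where \<chi>: "(\<chi>, u) \<in> elts \<upsilon>" "r' \<le> r" "r' \<le> u" "(\<rho> \<^bold>= \<chi>) r'"
      using fEqE[OF 1(3) \<rho>(1) order_trans[OF \<rho>(2) \<pi>(2)] \<rho>(3)] .
    have "(\<pi> \<^bold>= \<chi>) r'"
      using IH[OF \<pi>(1)] \<rho>(4) \<chi>(2,4) by (blast intro: fEq_mono)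
    then show "\<exists>(\<chi>, u)\<in>elts \<upsilon>. \<exists>r\<le>q. r \<le> u \<and> (\<pi> \<^bold>= \<chi>) r"
      using \<rho>(2) \<chi>(1-3) order_trans by fast
  next
    fix \<chi> u q assume \<chi>: "(\<chi>, u) \<in> elts \<upsilon>" "q \<le> p" "q \<le> u"
    obtain \<rho> t r where \<rho>: "(\<rho>, t) \<in> elts \<tau>" "r \<le> q" "r \<le> t" "(\<chi> \<^bold>= \<rho>) r"
      using fEqE[OF fEq_sym[OF 1(3)] \<chi>] .
    obtain \<pi> s r' where \<pi>: "(\<pi>, s) \<in> elts \<sigma>" "r' \<le> r" "r' \<le> s" "(\<rho> \<^bold>= \<pi>) r'"
      using fEqE[OF fEq_sym[OF 1(2)] \<rho>(1) order_trans[OF \<rho>(2) \<chi>(2)] \<rho>(3)] .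
    have "(\<pi> \<^bold>= \<chi>) r'"
      using IH[OF \<pi>(1)] \<rho>(4) \<pi>(2,4) by (blast intro: fEq_mono fEq_sym)
    then show "\<exists>(\<pi>, s)\<in>elts \<sigma>. \<exists>r\<le>q. r \<le> s \<and> (\<pi> \<^bold>= \<chi>) r"
      using \<rho>(2) \<pi>(1-3) order_trans by fast
  qed
qed

section \<open>Membership and its compatibility with equality\<close>

lemma fMemE:
  assumes "(\<sigma> \<^bold>\<in> \<tau>) p" and "q \<le> p"
  obtains \<pi> s r where "r \<le> q" and "(\<pi>, s) \<in> elts \<tau>" and "r \<le> s" and "(\<sigma> \<^bold>= \<pi>) r"
proof -
  obtain r where r: "r \<le> q" "\<exists>(\<pi>, s)\<in>elts \<tau>. r \<le> s \<and> (\<pi> \<^bold>= \<sigma>) r"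
    using assms unfolding fMem_def by (rule dense_belowE)
  then obtain \<pi> s where \<pi>: "(\<pi>, s) \<in> elts \<tau>" "r \<le> s" "(\<pi> \<^bold>= \<sigma>) r"
    by blast
  show ?thesis
    by (rule that[OF r(1) \<pi>(1,2) fEq_sym[OF \<pi>(3)]])
qed

lemma fMemI:
  assumes "\<And>q. q \<le> p \<Longrightarrow> \<exists>\<pi> s r. r \<le> q \<and> (\<pi>, s) \<in> elts \<tau> \<and> r \<le> s \<and> (\<sigma> \<^bold>= \<pi>) r"
  shows "(\<sigma> \<^bold>\<in> \<tau>) p"
  unfolding fMem_def
proof (rule dense_belowI)
  fix q assume "q \<le> p"
  from assms[OF this] obtain \<pi> s r where "r \<le> q" "(\<pi>, s) \<in> elts \<tau>" "r \<le> s" "(\<sigma> \<^bold>= \<pi>) r"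
    by blast
  moreover from this(4) have "(\<pi> \<^bold>= \<sigma>) r"
    by (rule fEq_sym)
  ultimately show "\<exists>r\<le>q. \<exists>(\<pi>, s)\<in>elts \<tau>. r \<le> s \<and> (\<pi> \<^bold>= \<sigma>) r"
    by blast
qed

lemma elts_imp_fMem:
  assumes "(\<sigma>, s) \<in> elts \<tau>" and "p \<le> s"
  shows "(\<sigma> \<^bold>\<in> \<tau>) p"
proof (rule fMemI)
  fix q assume "q \<le> p"
  then have "q \<le> s" using assms(2) by simp
  then show "\<exists>\<pi> s r. r \<le> q \<and> (\<pi>, s) \<in> elts \<tau> \<and> r \<le> s \<and> (\<sigma> \<^bold>= \<pi>) r"
    using assms(1) fEq_refl by blast
qed

lemma fMem_cong_left:
  assumes "(\<sigma> \<^bold>= \<sigma>') p" and "(\<sigma> \<^bold>\<in> \<tau>) p"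
  shows "(\<sigma>' \<^bold>\<in> \<tau>) p"
proof (rule fMemI)
  fix q assume "q \<le> p"
  with assms(2) obtain \<pi> s r where \<pi>: "r \<le> q" "(\<pi>, s) \<in> elts \<tau>" "r \<le> s" "(\<sigma> \<^bold>= \<pi>) r"
    by (rule fMemE)
  have "(\<sigma>' \<^bold>= \<sigma>) r"
    using fEq_mono[OF fEq_sym[OF assms(1)]] \<open>q \<le> p\<close> \<pi>(1) order_trans by blast
  then have "(\<sigma>' \<^bold>= \<pi>) r"
    using \<pi>(4) by (rule fEq_trans)
  then show "\<exists>\<pi> s r. r \<le> q \<and> (\<pi>, s) \<in> elts \<tau> \<and> r \<le> s \<and> (\<sigma>' \<^bold>= \<pi>) r"
    using \<pi> by blast
qed

lemma fMem_cong_right: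
  assumes "(\<tau> \<^bold>= \<tau>') p" and "(\<sigma> \<^bold>\<in> \<tau>) p"
  shows "(\<sigma> \<^bold>\<in> \<tau>') p"
proof (rule fMemI)
  fix q assume "q \<le> p"
  with assms(2) obtain \<pi> s r where \<pi>: "r \<le> q" "(\<pi>, s) \<in> elts \<tau>" "r \<le> s" "(\<sigma> \<^bold>= \<pi>) r"
    by (rule fMemE)
  have "r \<le> p" using \<open>q \<le> p\<close> \<pi>(1) by simp
  from fEqE[OF assms(1) \<pi>(2) this \<pi>(3)] obtain \<rho> t r' where
    \<rho>: "(\<rho>, t) \<in> elts \<tau>'" "r' \<le> r" "r' \<le> t" "(\<pi> \<^bold>= \<rho>) r'" .
  have "(\<sigma> \<^bold>= \<rho>) r'"
    using fEq_mono[OF \<pi>(4) \<rho>(2)] \<rho>(4) by (rule fEq_trans)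
  then show "\<exists>\<pi> s r. r \<le> q \<and> (\<pi>, s) \<in> elts \<tau>' \<and> r \<le> s \<and> (\<sigma> \<^bold>= \<pi>) r"
    using \<rho> \<pi>(1) order_trans by blast
qed

text \<open>This is the axiom of extensionality in the extension. It replaces the recursive clauses
  of \<open>fEq\<close> in most later proofs that two names are equal.\<close>

lemma fEq_extensionality:
  assumes "\<And>\<sigma> q. q \<le> p \<Longrightarrow> (\<sigma> \<^bold>\<in> \<tau>) q \<longleftrightarrow> (\<sigma> \<^bold>\<in> \<tau>') q"
  shows "(\<tau> \<^bold>= \<tau>') p"
proof (rule fEqI)
  fix \<pi> s q assume "(\<pi>, s) \<in> elts \<tau>" "q \<le> p" "q \<le> s"
  then have "(\<pi> \<^bold>\<in> \<tau>') q"
    using assms[of q \<pi>] elts_imp_fMem[of \<pi> s \<tau> q] by simp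
  then obtain \<rho> t r where "r \<le> q" "(\<rho>, t) \<in> elts \<tau>'" "r \<le> t" "(\<pi> \<^bold>= \<rho>) r"
    by (rule fMemE[OF _ order_refl])
  then show "\<exists>(\<rho>, t)\<in>elts \<tau>'. \<exists>r\<le>q. r \<le> t \<and> (\<pi> \<^bold>= \<rho>) r"
    by blast
next
  fix \<rho> t q assume "(\<rho>, t) \<in> elts \<tau>'" "q \<le> p" "q \<le> t"
  then have "(\<rho> \<^bold>\<in> \<tau>) q"
    using assms[of q \<rho>] elts_imp_fMem[of \<rho> t \<tau>' q] by simp
  then obtain \<pi> s r where \<pi>: "r \<le> q" "(\<pi>, s) \<in> elts \<tau>" "r \<le> s" "(\<rho> \<^bold>= \<pi>) r"
    by (rule fMemE[OF _ order_refl])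
  then show "\<exists>(\<pi>, s)\<in>elts \<tau>. \<exists>r\<le>q. r \<le> s \<and> (\<pi> \<^bold>= \<rho>) r"
    using fEq_sym[OF \<pi>(4)] by blast
qed

lemma fMem_image_top_iff:
  fixes \<tau> :: "('k, 'p::order_top) name"
  assumes "elts \<tau> = (\<lambda>i. (g i, top)) ` I"
  shows "(\<sigma> \<^bold>\<in> \<tau>) p \<longleftrightarrow> dense_below p (\<lambda>q. \<exists>i\<in>I. (\<sigma> \<^bold>= g i) q)"
  unfolding fMem_def assms by (simp add: fEq_commute[of \<sigma>])


section \<open>Names for sets of the ground model\<close>

text \<open>\<open>mk_name\<close> is reliable only for sets that fit into \<open>'k\<close>. The
  names of numerals, pairs, subsets of the plane and sequences are all countable, so an infinite
  \<open>'k\<close> serves them.\<close>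

lemma elts_mk_name_countable:
  fixes A :: "(('k, 'p) name \<times> 'p) set"
  assumes "infinite (UNIV :: 'k set)" and "countable A"
  shows "elts (mk_name A) = A"
proof -
  obtain h :: "nat \<Rightarrow> 'k" where "inj h"
    using infinite_countable_subset[OF assms(1)] by blast
  then have "inj_on (h \<circ> to_nat_on A) A"
    using inj_on_to_nat_on[OF assms(2)] by (auto intro: comp_inj_on inj_on_subset)
  from elts_mk_name[OF this, of "\<lambda>x. x"] show ?thesis by simp
qed

abbreviation opair_name :: "('k, 'p::order_top) name \<Rightarrow> ('k, 'p) name \<Rightarrow> ('k, 'p) name" where
  "opair_name \<sigma> \<tau> \<equiv> upair_name (upair_name \<sigma> \<sigma>) (upair_name \<sigma> \<tau>)"

text \<open>A name for the function on \<open>I\<close> with values \<open>y i\<close>, as a set of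
  Kuratowski pairs. It serves both for the bijection witnessing finiteness and for the convergent
  sequence of the main argument.\<close>

definition seq_name :: "nat set \<Rightarrow> (nat \<Rightarrow> ('k, 'p::order_top) name) \<Rightarrow> ('k, 'p) name" where
  "seq_name I y = mk_name ((\<lambda>i. (opair_name (nat_name i) (y i), top)) ` I)"

context
  assumes inf: "infinite (UNIV :: 'k set)"
begin

lemma elts_nat_name: "elts (nat_name n :: ('k, 'p::order_top) name) = (\<lambda>i. (nat_name i, top)) ` {..<n}"
  by (induction n) (simp_all add: elts_mk_name_countable[OF inf] lessThan_Suc)

lemma elts_omega_name: "elts (omega_name :: ('k, 'p::order_top) name) = (\<lambda>i. (nat_name i, top)) ` UNIV"
  unfolding omega_name_def by (rule elts_mk_name_countable[OF inf]) simp

lemma elts_upair_name: "elts (upair_name \<sigma> \<tau> :: ('k, 'p::order_top) name) = {(\<sigma>, top), (\<tau>, top)}"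
  unfolding upair_name_def by (rule elts_mk_name_countable[OF inf]) simp

lemma elts_check_name: "elts (check_name A :: ('k, 'p::order_top) name) = (\<lambda>z. (pair_name z, top)) ` A"
  unfolding check_name_def by (rule elts_mk_name_countable[OF inf]) simp

lemma elts_seq_name:
  "elts (seq_name I y :: ('k, 'p::order_top) name) = (\<lambda>i. (opair_name (nat_name i) (y i), top)) ` I"
  unfolding seq_name_def by (rule elts_mk_name_countable[OF inf]) simp

lemmas fMem_nat_name_iff = fMem_image_top_iff[OF elts_nat_name]
  and fMem_omega_name_iff = fMem_image_top_iff[OF elts_omega_name]
  and fMem_check_name_iff = fMem_image_top_iff[OF elts_check_name]
  and fMem_seq_name_iff = fMem_image_top_iff[OF elts_seq_name]

lemma fMem_upair_name_iff:
  fixes \<sigma> a b :: "('k, 'p::order_top) name"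
  shows "(\<sigma> \<^bold>\<in> upair_name a b) p \<longleftrightarrow> dense_below p (\<lambda>q. (\<sigma> \<^bold>= a) q \<or> (\<sigma> \<^bold>= b) q)"
  unfolding fMem_def elts_upair_name by (simp add: fEq_commute[of \<sigma>])

lemma fMem_upair_name_same_iff:
  fixes \<sigma> a :: "('k, 'p::order_top) name"
  shows "(\<sigma> \<^bold>\<in> upair_name a a) p \<longleftrightarrow> (\<sigma> \<^bold>= a) p"
  using regular_fEq[of \<sigma> a] unfolding fMem_upair_name_iff regular_def by simp

text \<open>If \<open>m < n\<close>, equality would put numeral \<open>m\<close> into itself. Some
  stronger condition then identifies it with a numeral \<open>i < m\<close>, and the induction
  hypothesis at \<open>i\<close> gives \<open>m \<le> i\<close>.\<close>

lemma nat_name_eq_imp_ge: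
  fixes p :: "'p::order_top"
  shows "(nat_name m \<^bold>= (nat_name n :: ('k, 'p) name)) p \<Longrightarrow> n \<le> m"
proof (induction m arbitrary: n p rule: less_induct)
  case (less m)
  show ?case
  proof (rule ccontr)
    assume "\<not> n \<le> m"
    then have "(nat_name m \<^bold>\<in> (nat_name n :: ('k, 'p) name)) p"
      by (intro elts_imp_fMem[of _ top]) (auto simp: elts_nat_name)
    then have "(nat_name m \<^bold>\<in> (nat_name m :: ('k, 'p) name)) p"
      using fMem_cong_right[OF fEq_sym[OF less.prems]] by blast
    then obtain i q where "i < m" "(nat_name m \<^bold>= (nat_name i :: ('k, 'p) name)) q"
      unfolding fMem_nat_name_iff dense_below_def by blast
    then show False
      using less.IH[OF \<open>i < m\<close> fEq_sym] by fastforce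
  qed
qed

lemma nat_name_eq_iff [simp]:
  fixes p :: "'p::order_top"
  shows "(nat_name m \<^bold>= (nat_name n :: ('k, 'p) name)) p \<longleftrightarrow> m = n"
proof
  assume eq: "(nat_name m \<^bold>= (nat_name n :: ('k, 'p) name)) p"
  show "m = n"
    using nat_name_eq_imp_ge[OF eq] nat_name_eq_imp_ge[OF fEq_sym[OF eq]] by simp
qed simp

lemma nat_name_mem_iff:
  fixes p :: "'p::order_top"
  shows "(nat_name m \<^bold>\<in> (nat_name n :: ('k, 'p) name)) p \<longleftrightarrow> m < n"
  unfolding fMem_nat_name_iff by (auto simp: dense_below_def)

lemma nat_name_mem_omega:
  fixes p :: "'p::order_top"
  shows "(nat_name m \<^bold>\<in> (omega_name :: ('k, 'p) name)) p"
  unfolding fMem_omega_name_iff by (auto simp: dense_below_def)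

section \<open>Unordered and Kuratowski pairs of names\<close>

lemma upair_name_cong:
  fixes a b :: "('k, 'p::order_top) name"
  assumes "(a \<^bold>= a') p" and "(b \<^bold>= b') p"
  shows "(upair_name a b \<^bold>= upair_name a' b') p"
proof (rule fEq_extensionality)
  fix \<sigma> q assume "q \<le> p"
  then have "(\<sigma> \<^bold>= a) r \<longleftrightarrow> (\<sigma> \<^bold>= a') r" "(\<sigma> \<^bold>= b) r \<longleftrightarrow> (\<sigma> \<^bold>= b') r" if "r \<le> q" for r
    using assms[THEN fEq_mono, of r] that order_trans[of r q p] by (meson fEq_sym fEq_trans)+
  then show "(\<sigma> \<^bold>\<in> upair_name a b) q \<longleftrightarrow> (\<sigma> \<^bold>\<in> upair_name a' b') q"
    unfolding fMem_upair_name_iff dense_below_def by (meson order_trans)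
qed

lemma opair_name_cong:
  fixes a b :: "('k, 'p::order_top) name"
  assumes "(a \<^bold>= a') p" and "(b \<^bold>= b') p"
  shows "(opair_name a b \<^bold>= opair_name a' b') p"
  by (intro upair_name_cong assms)

lemma upair_name_eqD:
  fixes a b c d :: "('k, 'p::order_top) name"
  assumes "(upair_name a b \<^bold>= upair_name c d) p"
  shows "dense_below p (\<lambda>q. (a \<^bold>= c) q \<or> (a \<^bold>= d) q)" and "dense_below p (\<lambda>q. (b \<^bold>= c) q \<or> (b \<^bold>= d) q)"
proof -
  have "(a \<^bold>\<in> upair_name c d) p" "(b \<^bold>\<in> upair_name c d) p"
    using assms by (auto intro!: fMem_cong_right[OF assms] elts_imp_fMem[of _ top] simp: elts_upair_name)
  then show "dense_below p (\<lambda>q. (a \<^bold>= c) q \<or> (a \<^bold>= d) q)" "dense_below p (\<lambda>q. (b \<^bold>= c) q \<or> (b \<^bold>= d) q)"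
    unfolding fMem_upair_name_iff .
qed

lemma singleton_eq_upair_nameD:
  fixes a c d :: "('k, 'p::order_top) name"
  assumes "(upair_name a a \<^bold>= upair_name c d) p"
  shows "(a \<^bold>= c) p"
proof -
  have "(c \<^bold>\<in> upair_name a a) p"
    by (auto intro!: fMem_cong_right[OF fEq_sym[OF assms]] elts_imp_fMem[of _ top] simp: elts_upair_name)
  then show ?thesis
    using fMem_upair_name_same_iff fEq_commute by blast
qed

lemma opair_name_eq_fst:
  fixes a b c d :: "('k, 'p::order_top) name"
  assumes "(opair_name a b \<^bold>= opair_name c d) p"
  shows "(a \<^bold>= c) p"
proof (rule regularI_dense[OF regular_fEq])
  fix q assume "q \<le> p"
  with upair_name_eqD(1)[OF assms] obtain r where
    "r \<le> q" "(upair_name a a \<^bold>= upair_name c c) r \<or> (upair_name a a \<^bold>= upair_name c d) r"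
    by (rule dense_belowE)
  then show "\<exists>r\<le>q. (a \<^bold>= c) r"
    using singleton_eq_upair_nameD by blast
qed

lemma opair_name_eq_snd_or:
  fixes a b c d :: "('k, 'p::order_top) name"
  assumes "(opair_name a b \<^bold>= opair_name c d) p"
  shows "dense_below p (\<lambda>q. (b \<^bold>= c) q \<or> (b \<^bold>= d) q)"
proof (rule dense_belowI)
  fix q assume "q \<le> p"
  with upair_name_eqD(2)[OF assms] obtain r where
    r: "r \<le> q" "(upair_name a b \<^bold>= upair_name c c) r \<or> (upair_name a b \<^bold>= upair_name c d) r"
    by (rule dense_belowE)
  then have "dense_below r (\<lambda>q. (b \<^bold>= c) q \<or> (b \<^bold>= d) q)"
    using upair_name_eqD(2)[of a b c c r] upair_name_eqD(2)[of a b c d r]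
    by (auto elim: dense_below_mono)
  then show "\<exists>r\<le>q. (b \<^bold>= c) r \<or> (b \<^bold>= d) r"
    using r(1) unfolding dense_below_def by (meson order_refl order_trans)
qed

text \<open>The classical Kuratowski argument, below a condition deciding the alternatives: the
  first coordinates agree, so if \<open>b\<close> equals \<open>c\<close>, then \<open>d\<close> is
  \<open>a\<close> or \<open>b\<close>, and both of these equal \<open>c\<close>.\<close>

lemma opair_name_eq_snd:
  fixes a b c d :: "('k, 'p::order_top) name"
  assumes "(opair_name a b \<^bold>= opair_name c d) p"
  shows "(b \<^bold>= d) p"
proof (rule regularI_dense[OF regular_fEq])
  fix q assume q: "q \<le> p"
  with opair_name_eq_snd_or[OF assms] obtain r where r: "r \<le> q" "(b \<^bold>= c) r \<or> (b \<^bold>= d) r"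
    by (rule dense_belowE)
  have "r \<le> p" using q r(1) by simp
  with opair_name_eq_snd_or[OF fEq_sym[OF assms]] obtain s where
    s: "s \<le> r" "(d \<^bold>= a) s \<or> (d \<^bold>= b) s"
    by (rule dense_belowE)
  have "(a \<^bold>= c) s"
    using fEq_mono[OF opair_name_eq_fst[OF assms]] s(1) \<open>r \<le> p\<close> order_trans by blast
  moreover have "(b \<^bold>= c) s \<or> (b \<^bold>= d) s"
    using r(2) s(1) fEq_mono by blast
  ultimately have "(b \<^bold>= d) s"
    using s(2) by (meson fEq_sym fEq_trans)
  then show "\<exists>r\<le>q. (b \<^bold>= d) r"
    using r(1) s(1) order_trans by blast
qed

lemma pair_name_eq_iff [simp]:
  fixes p :: "'p::order_top"
  shows "(pair_name z \<^bold>= (pair_name w :: ('k, 'p) name)) p \<longleftrightarrow> z = w"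
proof
  assume "(pair_name z \<^bold>= (pair_name w :: ('k, 'p) name)) p"
  then show "z = w"
    using opair_name_eq_fst opair_name_eq_snd unfolding pair_name_def
    by (metis nat_name_eq_iff prod_eqI)
qed simp

lemma pair_name_mem_check_iff:
  fixes p :: "'p::order_top"
  shows "(pair_name z \<^bold>\<in> (check_name A :: ('k, 'p) name)) p \<longleftrightarrow> z \<in> A"
  unfolding fMem_check_name_iff by (auto simp: dense_below_def)

section \<open>Formulas about pairs as statements on canonical names\<close>

lemma fIsUpair_iff:
  fixes z a b :: "('k, 'p::order_top) name"
  shows "fIsUpair z a b p \<longleftrightarrow> (z \<^bold>= upair_name a b) p"
proof -
  have *: "fIsUpair z a b p \<longleftrightarrow> (\<forall>x. \<forall>q\<le>p. (x \<^bold>\<in> z) q \<longleftrightarrow> (x \<^bold>\<in> upair_name a b) q)"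
    unfolding fIsUpair_def by (simp add: forcing_iffs regular_intros fMem_upair_name_iff)
  show ?thesis
    unfolding * using fEq_extensionality fMem_cong_right fEq_mono fEq_sym by blast
qed

text \<open>The inner existential witnesses are themselves equal to canonical unordered pairs, so
  congruence removes both quantifiers. Later arguments handle only
  \<open>opair_name\<close>.\<close>

lemma fIsPair_iff:
  fixes z a b :: "('k, 'p::order_top) name"
  shows "fIsPair z a b p \<longleftrightarrow> (z \<^bold>= opair_name a b) p"
proof -
  have "fIsPair z a b p \<longleftrightarrow> dense_below p (\<lambda>q. \<exists>u. dense_below q (\<lambda>r. \<exists>v.
    (u \<^bold>= upair_name a a) r \<and> (v \<^bold>= upair_name a b) r \<and> (z \<^bold>= upair_name u v) r))"
    unfolding fIsPair_def by (simp add: fEx_iff fAnd_iff fIsUpair_iff)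
  also have "\<dots> \<longleftrightarrow> (z \<^bold>= opair_name a b) p"
  proof
    assume *: "dense_below p (\<lambda>q. \<exists>u. dense_below q (\<lambda>r. \<exists>v.
      (u \<^bold>= upair_name a a) r \<and> (v \<^bold>= upair_name a b) r \<and> (z \<^bold>= upair_name u v) r))"
    show "(z \<^bold>= opair_name a b) p"
    proof (rule regularI_dense[OF regular_fEq])
      fix q assume "q \<le> p"
      then obtain r u where "r \<le> q" "dense_below r (\<lambda>r. \<exists>v.
          (u \<^bold>= upair_name a a) r \<and> (v \<^bold>= upair_name a b) r \<and> (z \<^bold>= upair_name u v) r)"
        using * by (auto elim: dense_belowE)
      moreover from this(2) obtain s v where
        "s \<le> r" "(u \<^bold>= upair_name a a) s" "(v \<^bold>= upair_name a b) s" "(z \<^bold>= upair_name u v) s"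
        using dense_belowE[OF _ order_refl] by blast
      ultimately show "\<exists>r\<le>q. (z \<^bold>= opair_name a b) r"
        using upair_name_cong fEq_trans order_trans by blast
    qed
  next
    assume "(z \<^bold>= opair_name a b) p"
    then show "dense_below p (\<lambda>q. \<exists>u. dense_below q (\<lambda>r. \<exists>v.
      (u \<^bold>= upair_name a a) r \<and> (v \<^bold>= upair_name a b) r \<and> (z \<^bold>= upair_name u v) r))"
      unfolding dense_below_def using fEq_refl fEq_mono by (meson order_refl order_trans)
  qed
  finally show ?thesis .
qed

lemma fMapsto_iff:
  fixes f x y :: "('k, 'p::order_top) name"
  shows "fMapsto f x y p \<longleftrightarrow> (opair_name x y \<^bold>\<in> f) p"
proof -
  have *: "(\<exists>z. (z \<^bold>\<in> f) q \<and> (z \<^bold>= opair_name x y) q) \<longleftrightarrow> (opair_name x y \<^bold>\<in> f) q" for q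
    using fMem_cong_left fEq_refl by blast
  show ?thesis
    using regular_fMem[of "opair_name x y" f]
    unfolding fMapsto_def fBex_iff fIsPair_iff * regular_def by simp
qed

end


section \<open>Functions, finiteness and convergence in the forcing language\<close>

lemma fSubset_iff: "(a \<^bold>\<subseteq> b) p \<longleftrightarrow> (\<forall>x. \<forall>q\<le>p. (x \<^bold>\<in> a) q \<longrightarrow> (x \<^bold>\<in> b) q)"
  by (simp add: fSubset_def forcing_iffs regular_intros)

lemma regular_fIsPair: "regular (fIsPair z a b)"
  by (simp add: fIsPair_def regular_intros)

lemma regular_fMapsto: "regular (fMapsto f x y)"
  by (simp add: fMapsto_def regular_intros)

lemma regular_fSubset: "regular (a \<^bold>\<subseteq> b)"
  by (simp add: fSubset_def regular_intros)

lemma regular_fFunction: "regular (fFunction f A B)"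
  by (simp add: fFunction_def regular_intros)

lemma regular_fFinite: "regular (fFinite F)"
  by (simp add: fFinite_def regular_intros)

lemma regular_fOpen: "regular (fOpen S W)"
  by (simp add: fOpen_def regular_intros)

lemma regular_fConverges: "regular (fConverges S f b)"
  by (simp add: fConverges_def regular_intros)

lemma regular_fIsInter: "regular (fIsInter c f X)"
  by (simp add: fIsInter_def regular_intros)

lemmas regular_formulas = regular_intros regular_fMapsto regular_fIsPair regular_fSubset
  regular_fFunction regular_fFinite regular_fOpen regular_fConverges regular_fIsInter

context
  assumes inf: "infinite (UNIV :: 'k set)"
begin

lemma fFunction_iff:
  fixes f A B :: "('k, 'p::order_top) name"
  shows "fFunction f A B p \<longleftrightarrow>
    (\<forall>z. \<forall>q\<le>p. (z \<^bold>\<in> f) q \<longrightarrow> dense_below q (\<lambda>r. \<exists>x. (x \<^bold>\<in> A) r \<and>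
       dense_below r (\<lambda>s. \<exists>y. (y \<^bold>\<in> B) s \<and> (z \<^bold>= opair_name x y) s))) \<and>
    (\<forall>x. \<forall>q\<le>p. (x \<^bold>\<in> A) q \<longrightarrow> dense_below q (\<lambda>r. \<exists>y. (y \<^bold>\<in> B) r \<and>
       (opair_name x y \<^bold>\<in> f) r \<and> (\<forall>y'. \<forall>s\<le>r. (opair_name x y' \<^bold>\<in> f) s \<longrightarrow> (y' \<^bold>= y) s)))"
  unfolding fFunction_def
  by (simp add: forcing_iffs regular_formulas fIsPair_iff[OF inf] fMapsto_iff[OF inf])

lemma fBijection_iff:
  fixes f A B :: "('k, 'p::order_top) name"
  shows "fBijection f A B p \<longleftrightarrow> fFunction f A B p \<and>
    (\<forall>y. \<forall>q\<le>p. (y \<^bold>\<in> B) q \<longrightarrow> dense_below q (\<lambda>r. \<exists>x. (x \<^bold>\<in> A) r \<and>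
       (opair_name x y \<^bold>\<in> f) r \<and> (\<forall>x'. \<forall>s\<le>r. (opair_name x' y \<^bold>\<in> f) s \<longrightarrow> (x' \<^bold>= x) s)))"
  unfolding fBijection_def by (simp add: forcing_iffs regular_formulas fMapsto_iff[OF inf])

section \<open>Functions given by sequences of names\<close>

lemma opair_name_mem_seq_nameE:
  fixes x y :: "('k, 'p::order_top) name"
  assumes "(opair_name x y \<^bold>\<in> seq_name I c) p" and "q \<le> p"
  obtains r i where "r \<le> q" and "i \<in> I" and "(x \<^bold>= nat_name i) r" and "(y \<^bold>= c i) r"
proof -
  obtain r where r: "r \<le> q" "\<exists>i\<in>I. (opair_name x y \<^bold>= opair_name (nat_name i) (c i)) r"
    using assms unfolding fMem_seq_name_iff[OF inf] by (rule dense_belowE)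
  then obtain i where i: "i \<in> I" "(opair_name x y \<^bold>= opair_name (nat_name i) (c i)) r"
    by blast
  show ?thesis
    by (rule that[OF r(1) i(1) opair_name_eq_fst[OF inf i(2)] opair_name_eq_snd[OF inf i(2)]])
qed

lemma opair_name_mem_seq_nameI:
  fixes x y :: "('k, 'p::order_top) name"
  assumes "i \<in> I" and "(x \<^bold>= nat_name i) p" and "(y \<^bold>= c i) p"
  shows "(opair_name x y \<^bold>\<in> seq_name I c) p"
proof (rule fMem_cong_left)
  show "(opair_name (nat_name i) (c i) \<^bold>= opair_name x y) p"
    by (rule fEq_sym[OF opair_name_cong[OF inf assms(2,3)]])
  show "(opair_name (nat_name i) (c i) \<^bold>\<in> seq_name I c) p"
    using assms(1) by (intro elts_imp_fMem[of _ top]) (auto simp: elts_seq_name[OF inf])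
qed

lemma opair_nat_name_mem_seq_nameD:
  fixes x y :: "('k, 'p::order_top) name"
  assumes "(opair_name x y \<^bold>\<in> seq_name I c) p" and "(x \<^bold>= nat_name i) p"
  shows "(y \<^bold>= c i) p"
proof (rule regularI_dense[OF regular_fEq])
  fix q assume q: "q \<le> p"
  with assms(1) obtain r j where r: "r \<le> q" "(x \<^bold>= nat_name j) r" "(y \<^bold>= c j) r"
    by (rule opair_name_mem_seq_nameE)
  have "(x \<^bold>= nat_name i) r"
    by (rule fEq_mono[OF assms(2)]) (use q r(1) in auto)
  then have "(nat_name i \<^bold>= (nat_name j :: ('k, 'p) name)) r"
    by (rule fEq_trans[OF fEq_sym r(2)])
  then have "i = j"
    by (simp add: nat_name_eq_iff[OF inf])
  then show "\<exists>r\<le>q. (y \<^bold>= c i) r"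
    using r(1,3) by blast
qed

text \<open>The domain is left as any name listing numerals, so that it can be a finite numeral as
  well as \<open>omega_name\<close>. Distinct numerals are never identified, which gives uniqueness
  of values.\<close>

lemma fFunction_seq_name:
  fixes A B :: "('k, 'p::order_top) name"
  assumes A: "elts A = (\<lambda>i. (nat_name i, top)) ` I"
    and B: "\<And>i. i \<in> I \<Longrightarrow> (c i \<^bold>\<in> B) p"
  shows "fFunction (seq_name I c) A B p"
  unfolding fFunction_iff
proof (intro conjI allI impI)
  fix z q assume q: "q \<le> p" and z: "(z \<^bold>\<in> seq_name I c) q"
  have memA: "(nat_name i \<^bold>\<in> A) r" if "i \<in> I" for i r
    by (rule elts_imp_fMem[of _ top]) (use that in \<open>auto simp: A\<close>)
  have memB: "(c i \<^bold>\<in> B) r" if "i \<in> I" "r \<le> q" for i r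
    by (rule fMem_mono[OF B[OF that(1)]]) (use that(2) q in auto)
  show "dense_below q (\<lambda>r. \<exists>x. (x \<^bold>\<in> A) r \<and>
       dense_below r (\<lambda>s. \<exists>y. (y \<^bold>\<in> B) s \<and> (z \<^bold>= opair_name x y) s))"
  proof (rule dense_belowI)
    fix r assume "r \<le> q"
    then obtain s i where s: "s \<le> r" "i \<in> I" "(z \<^bold>= opair_name (nat_name i) (c i)) s"
      using z unfolding fMem_seq_name_iff[OF inf] dense_below_def by blast
    have "(c i \<^bold>\<in> B) t \<and> (z \<^bold>= opair_name (nat_name i) (c i)) t" if "t \<le> s" for t
      using memB[OF s(2), of t] fEq_mono[OF s(3) that] that s(1) \<open>r \<le> q\<close> by auto
    then have "dense_below s (\<lambda>s. \<exists>y. (y \<^bold>\<in> B) s \<and> (z \<^bold>= opair_name (nat_name i) y) s)"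
      unfolding dense_below_def by blast
    then show "\<exists>r'\<le>r. \<exists>x. (x \<^bold>\<in> A) r' \<and>
       dense_below r' (\<lambda>s. \<exists>y. (y \<^bold>\<in> B) s \<and> (z \<^bold>= opair_name x y) s)"
      using memA[OF s(2)] s(1) by blast
  qed
next
  fix x q assume q: "q \<le> p" and x: "(x \<^bold>\<in> A) q"
  show "dense_below q (\<lambda>r. \<exists>y. (y \<^bold>\<in> B) r \<and> (opair_name x y \<^bold>\<in> seq_name I c) r \<and>
      (\<forall>y'. \<forall>s\<le>r. (opair_name x y' \<^bold>\<in> seq_name I c) s \<longrightarrow> (y' \<^bold>= y) s))"
  proof (rule dense_belowI)
    fix r assume r: "r \<le> q"
    then obtain s i where s: "s \<le> r" "i \<in> I" "(x \<^bold>= nat_name i) s"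
      using x unfolding fMem_image_top_iff[OF A] dense_below_def by blast
    have "(c i \<^bold>\<in> B) s"
      by (rule fMem_mono[OF B[OF s(2)]]) (use s(1) r q in auto)
    moreover have "(opair_name x (c i) \<^bold>\<in> seq_name I c) s"
      using s(2,3) by (rule opair_name_mem_seq_nameI) simp
    moreover have "(y' \<^bold>= c i) t" if "t \<le> s" "(opair_name x y' \<^bold>\<in> seq_name I c) t" for y' t
      using that(2) fEq_mono[OF s(3) that(1)] by (rule opair_nat_name_mem_seq_nameD)
    ultimately show "\<exists>r'\<le>r. \<exists>y. (y \<^bold>\<in> B) r' \<and> (opair_name x y \<^bold>\<in> seq_name I c) r' \<and>
      (\<forall>y'. \<forall>s\<le>r'. (opair_name x y' \<^bold>\<in> seq_name I c) s \<longrightarrow> (y' \<^bold>= y) s)"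
      using s(1) by blast
  qed
qed

section \<open>Finite sets in the extension\<close>

lemma fFinite_iff:
  fixes F :: "('k, 'p::order_top) name"
  shows "fFinite F p \<longleftrightarrow>
    dense_below p (\<lambda>q. \<exists>n. (n \<^bold>\<in> omega_name) q \<and> dense_below q (\<lambda>r. \<exists>f. fBijection f n F r))"
  unfolding fFinite_def fBex_iff fEx_iff ..

text \<open>The set \<open>X\<close> need not be decided by \<open>p\<close>. A maximal
  \<open>E\<close> that some \<open>q\<close> below \<open>p\<close> forces into \<open>X\<close>
  pins \<open>X\<close> down below \<open>q\<close>, and an enumeration of \<open>E\<close> is then
  the required bijection.\<close>

lemma fFinite_if_bounded:
  fixes X :: "('k, 'p::order_top) name"
  assumes sub: "(X \<^bold>\<subseteq> omega_name) p"
    and bounded: "\<And>n q. q \<le> p \<Longrightarrow> (nat_name n \<^bold>\<in> X) q \<Longrightarrow> n \<le> k"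
  shows "\<exists>q\<le>p. fFinite X q"
proof -
  define \<E> where "\<E> = {E. E \<subseteq> {..k} \<and> (\<exists>q\<le>p. \<forall>i\<in>E. (nat_name i \<^bold>\<in> X) q)}"
  have "finite \<E>"
    unfolding \<E>_def by (rule finite_subset[of _ "Pow {..k}"]) auto
  moreover have "{} \<in> \<E>"
    unfolding \<E>_def by auto
  ultimately obtain E where E: "E \<in> \<E>" "\<forall>E'\<in>\<E>. E \<subseteq> E' \<longrightarrow> E = E'"
    using finite_has_maximal[of \<E>] by auto
  then obtain q where q: "q \<le> p" "\<And>i. i \<in> E \<Longrightarrow> (nat_name i \<^bold>\<in> X) q" and Ek: "E \<subseteq> {..k}"
    unfolding \<E>_def by blast
  \<comment> \<open>A further member decided below \<open>q\<close> would enlarge \<open>E\<close>,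
    against maximality.\<close>
  have only: "i \<in> E" if "r \<le> q" "(nat_name i \<^bold>\<in> X) r" for r i
  proof -
    have "i \<le> k" "r \<le> p"
      using bounded[of r i] that q(1) by auto
    moreover have "\<forall>j\<in>insert i E. (nat_name j \<^bold>\<in> X) r"
      using fMem_mono[OF q(2) that(1)] that(2) by simp
    ultimately have "insert i E \<in> \<E>"
      using Ek unfolding \<E>_def by blast
    then show ?thesis
      using E(2) by blast
  qed
  obtain h where h: "bij_betw h {..<card E} E"
    using ex_bij_betw_nat_finite[of E] finite_subset[OF Ek] by (auto simp: atLeast0LessThan)
  define f :: "('k, 'p) name" where "f = seq_name {..<card E} (\<lambda>i. nat_name (h i))"
  have bij: "fBijection f (nat_name (card E)) X r" if "r \<le> q" for r
    unfolding fBijection_iff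
  proof (intro conjI allI impI)
    show "fFunction f (nat_name (card E)) X r"
      unfolding f_def
    proof (rule fFunction_seq_name[OF elts_nat_name[OF inf]])
      show "(nat_name (h i) \<^bold>\<in> X) r" if "i \<in> {..<card E}" for i
        using fMem_mono[OF q(2) \<open>r \<le> q\<close>] bij_betwE[OF h] that by simp
    qed
  next
    fix y s assume s: "s \<le> r" and y: "(y \<^bold>\<in> X) s"
    show "dense_below s (\<lambda>r. \<exists>x. (x \<^bold>\<in> nat_name (card E)) r \<and>
       (opair_name x y \<^bold>\<in> f) r \<and> (\<forall>x'. \<forall>s\<le>r. (opair_name x' y \<^bold>\<in> f) s \<longrightarrow> (x' \<^bold>= x) s))"
    proof (rule dense_belowI)
      fix t assume t: "t \<le> s"
      have "t \<le> q" "t \<le> p"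
        using that s t q(1) by auto
      then have "(y \<^bold>\<in> omega_name) t"
        using sub fMem_mono[OF y t] unfolding fSubset_iff by simp
      then obtain u j where u: "u \<le> t" "(y \<^bold>= nat_name j) u"
        unfolding fMem_omega_name_iff[OF inf] dense_below_def by blast
      have "(y \<^bold>\<in> X) u"
        by (rule fMem_mono[OF y]) (use u(1) t in auto)
      then have "j \<in> E"
        using only[of u j] fMem_cong_left[OF u(2)] u(1) \<open>t \<le> q\<close> by auto
      then obtain i where i: "i < card E" "h i = j"
        using h by (force simp: bij_betw_def)
      have "(x' \<^bold>= nat_name i) v" if v: "v \<le> u" "(opair_name x' y \<^bold>\<in> f) v" for x' v
      proof (rule regularI_dense[OF regular_fEq])
        fix w assume w: "w \<le> v"
        with v(2) obtain w' i' where w': "w' \<le> w" "i' \<in> {..<card E}" "(x' \<^bold>= nat_name i') w'"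
          "(y \<^bold>= nat_name (h i')) w'"
          unfolding f_def by (rule opair_name_mem_seq_nameE)
        have "(y \<^bold>= nat_name j) w'"
          by (rule fEq_mono[OF u(2)]) (use w'(1) w v(1) in auto)
        then have "(nat_name (h i') \<^bold>= (nat_name j :: ('k, 'p) name)) w'"
          by (rule fEq_trans[OF fEq_sym[OF w'(4)]])
        then have "h i' = h i"
          using i(2) by (simp add: nat_name_eq_iff[OF inf])
        then have "i' = i"
          using h i(1) w'(2) by (auto simp: bij_betw_def inj_on_def)
        then show "\<exists>r\<le>w. (x' \<^bold>= nat_name i) r"
          using w'(1,3) by blast
      qed
      moreover have "(opair_name (nat_name i) y \<^bold>\<in> f) u"
        unfolding f_def by (rule opair_name_mem_seq_nameI[of i]) (use i u(2) in auto)
      moreover have "(nat_name i \<^bold>\<in> (nat_name (card E) :: ('k, 'p) name)) u"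
        using i(1) by (simp add: nat_name_mem_iff[OF inf])
      ultimately show "\<exists>r\<le>t. \<exists>x. (x \<^bold>\<in> nat_name (card E)) r \<and>
       (opair_name x y \<^bold>\<in> f) r \<and> (\<forall>x'. \<forall>s\<le>r. (opair_name x' y \<^bold>\<in> f) s \<longrightarrow> (x' \<^bold>= x) s)"
        using u(1) by blast
    qed
  qed
  have dense: "dense_below r (\<lambda>r. \<exists>f. fBijection f (nat_name (card E)) X r)" if "r \<le> q" for r
  proof (rule dense_belowI)
    fix s assume "s \<le> r"
    then have "fBijection f (nat_name (card E)) X s"
      using that by (intro bij) simp
    then show "\<exists>r\<le>s. \<exists>f. fBijection f (nat_name (card E)) X r"
      by blast
  qed
  have "fFinite X q"
    unfolding fFinite_iff
  proof (rule dense_belowI)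
    fix r assume "r \<le> q"
    then show "\<exists>r'\<le>r. \<exists>n. (n \<^bold>\<in> omega_name) r' \<and> dense_below r' (\<lambda>r. \<exists>f. fBijection f n X r)"
      using dense nat_name_mem_omega[OF inf] by blast
  qed
  then show ?thesis
    using q(1) by blast
qed

text \<open>First decide the size \<open>N\<close> and a bijection \<open>f\<close>, then in
  \<open>N\<close> further strengthenings decide the values of \<open>f\<close>. Each value is a
  pair from the ground model; collecting them gives a finite cover.\<close>

lemma finite_cover_if_fFinite:
  fixes F :: "('k, 'p::order_top) name"
  assumes sub: "(F \<^bold>\<subseteq> check_name S) p" and fin: "fFinite F p"
  shows "\<exists>q\<le>p. \<exists>A. finite A \<and> (F \<^bold>\<subseteq> check_name A) q"
proof -
  obtain q1 n where q1: "q1 \<le> p" "(n \<^bold>\<in> omega_name) q1" "dense_below q1 (\<lambda>r. \<exists>f. fBijection f n F r)"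
    using fin unfolding fFinite_iff dense_below_def[of p] by blast
  obtain q2 N where q2: "q2 \<le> q1" "(n \<^bold>= nat_name N) q2"
    using q1(2) unfolding fMem_omega_name_iff[OF inf] dense_below_def by blast
  obtain q3 f where q3: "q3 \<le> q2" "fBijection f n F q3"
    using q1(3) q2(1) unfolding dense_below_def by blast
  have n: "(x \<^bold>\<in> n) r \<longleftrightarrow> (x \<^bold>\<in> nat_name N) r" if "r \<le> q3" for x r
  proof -
    have "(n \<^bold>= nat_name N) r"
      by (rule fEq_mono[OF q2(2)]) (use that q3(1) in auto)
    then show ?thesis
      using fMem_cong_right fEq_sym by blast
  qed
  \<comment> \<open>Induction on the number \<open>k\<close> of values already decided. The bound
    \<open>k \<le> N\<close> ensures that the next numeral lies in the domain of
    \<open>f\<close>.\<close>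
  have "\<exists>q\<le>q3. \<exists>A. finite A \<and> (\<forall>i<k. \<forall>y. \<forall>r\<le>q. (opair_name (nat_name i) y \<^bold>\<in> f) r \<longrightarrow> (y \<^bold>\<in> check_name A) r)"
    if "k \<le> N" for k
    using that
  proof (induction k)
    case 0
    show ?case by auto
  next
    case (Suc k)
    then obtain q A where q: "q \<le> q3" "finite A"
      and A: "\<And>i y r. i < k \<Longrightarrow> r \<le> q \<Longrightarrow> (opair_name (nat_name i) y \<^bold>\<in> f) r \<Longrightarrow> (y \<^bold>\<in> check_name A) r"
      by auto
    have "(nat_name k \<^bold>\<in> n) q"
      using Suc.prems q(1) by (simp add: n nat_name_mem_iff[OF inf])
    then obtain r y where r: "r \<le> q" "(y \<^bold>\<in> F) r"
      "\<And>y' s. s \<le> r \<Longrightarrow> (opair_name (nat_name k) y' \<^bold>\<in> f) s \<Longrightarrow> (y' \<^bold>= y) s"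
      using q3(2) q(1) unfolding fBijection_iff fFunction_iff dense_below_def by (meson order_refl)
    have "r \<le> p"
      using r(1) q(1) q3(1) q2(1) q1(1) by simp
    then have "(y \<^bold>\<in> check_name S) r"
      using sub r(2) unfolding fSubset_iff by blast
    then obtain s z where s: "s \<le> r" "(y \<^bold>= pair_name z) s"
      unfolding fMem_check_name_iff[OF inf] dense_below_def by blast
    have "(y' \<^bold>\<in> check_name (insert z A)) t"
      if "i < Suc k" "t \<le> s" "(opair_name (nat_name i) y' \<^bold>\<in> f) t" for i y' t
    proof (cases "i = k")
      case True
      then have "(y' \<^bold>= y) t"
        using r(3)[of t y'] that s(1) by auto
      then have "(pair_name z \<^bold>= y') t"
        using fEq_sym[OF fEq_trans[OF _ fEq_mono[OF s(2) that(2)]]] by simp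
      then show ?thesis
        by (rule fMem_cong_left) (simp add: pair_name_mem_check_iff[OF inf])
    next
      case False
      then have "(y' \<^bold>\<in> check_name A) t"
        using A[of i t y'] that s(1) r(1) by auto
      then show ?thesis
        unfolding fMem_check_name_iff[OF inf] by (auto elim: dense_below_mono)
    qed
    moreover have "s \<le> q3"
      using s(1) r(1) q(1) by simp
    ultimately show ?case
      using q(2) by (meson finite_insert)
  qed
  from this[OF order_refl] obtain q A where q: "q \<le> q3" "finite A"
    and A: "\<And>i y r. i < N \<Longrightarrow> r \<le> q \<Longrightarrow> (opair_name (nat_name i) y \<^bold>\<in> f) r \<Longrightarrow> (y \<^bold>\<in> check_name A) r"
    by auto
  have "(F \<^bold>\<subseteq> check_name A) q"
    unfolding fSubset_iff
  proof (intro allI impI)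
    fix y r assume r: "r \<le> q" "(y \<^bold>\<in> F) r"
    show "(y \<^bold>\<in> check_name A) r"
    proof (rule regularI_dense[OF regular_fMem])
      fix s assume s: "s \<le> r"
      have "r \<le> q3" using r(1) q(1) by simp
      then have "dense_below r (\<lambda>r. \<exists>x. (x \<^bold>\<in> n) r \<and> (opair_name x y \<^bold>\<in> f) r)"
        using q3(2) r(2) unfolding fBijection_iff dense_below_def by (metis (no_types, lifting))
      then obtain t x where t: "t \<le> s" "(x \<^bold>\<in> n) t" "(opair_name x y \<^bold>\<in> f) t"
        using s unfolding dense_below_def by blast
      have "t \<le> q" "t \<le> q3" using t(1) s r(1) q(1) by auto
      then have "(x \<^bold>\<in> nat_name N) t"
        using n t(2) by blast
      then obtain u i where u: "u \<le> t" "i < N" "(x \<^bold>= nat_name i) u"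
        unfolding fMem_nat_name_iff[OF inf] dense_below_def by blast
      have "(opair_name (nat_name i) y \<^bold>\<in> f) u"
        by (rule fMem_cong_left[OF opair_name_cong[OF inf u(3) fEq_refl] fMem_mono[OF t(3) u(1)]])
      then have "(y \<^bold>\<in> check_name A) u"
        using A[OF u(2)] u(1) \<open>t \<le> q\<close> by auto
      moreover have "u \<le> s" using u(1) t(1) by simp
      ultimately show "\<exists>r\<le>s. (y \<^bold>\<in> check_name A) r"
        by blast
    qed
  qed
  moreover have "q \<le> p"
    using q(1) q3(1) q2(1) q1(1) by simp
  ultimately show ?thesis
    using q(2) by blast
qed

end


section \<open>The combinatorial core\<close>

text \<open>Membership in the carrier of \<open>cond\<close>, as a predicate, so that the
  combinatorics can work with plain sets.\<close>

definition positive :: "(nat \<times> nat) set \<Rightarrow> bool" where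
  "positive p \<longleftrightarrow> infinite {n. infinite (p `` {n})}"

lemma positive_mono:
  assumes "positive p" and "p \<subseteq> q"
  shows "positive q"
proof -
  have "infinite (q `` {n})" if "infinite (p `` {n})" for n
    using infinite_super[OF _ that] assms(2) by blast
  then have "{n. infinite (p `` {n})} \<subseteq> {n. infinite (q `` {n})}"
    by blast
  then show ?thesis
    using assms(1) infinite_super unfolding positive_def by blast
qed

text \<open>Outside the finitely many columns met by \<open>p - q\<close>, intersecting with
  \<open>q\<close> leaves \<open>p\<close> unchanged.\<close>

lemma positive_remove_columns:
  assumes "positive p" and "finite (fst ` (p - q))"
  shows "positive (p \<inter> q)"
proof -
  have "n \<in> {n. infinite ((p \<inter> q) `` {n})} \<union> fst ` (p - q)" if "infinite (p `` {n})" for n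
  proof (cases "n \<in> fst ` (p - q)")
    case False
    then have "(p \<inter> q) `` {n} = p `` {n}" by force
    then show ?thesis using that by simp
  qed simp
  then have "{n. infinite (p `` {n})} \<subseteq> {n. infinite ((p \<inter> q) `` {n})} \<union> fst ` (p - q)"
    by blast
  then show ?thesis
    using assms unfolding positive_def by (meson finite_UnI finite_subset)
qed

section \<open>Thinning and fusion, with \<open>F q c\<close> read as: \<open>q\<close> forces
  \<open>c\<close> into the base\<close>

context
  fixes F :: "(nat \<times> nat) set \<Rightarrow> (nat \<times> nat) set \<Rightarrow> bool"
  assumes F_almost: "\<And>q r c. F q c \<Longrightarrow> positive q \<Longrightarrow> positive r \<Longrightarrow> finite (fst ` (r - q)) \<Longrightarrow> F r c"
begin

text \<open>The columns in \<open>K\<close> must stay infinite for the later fusion. The second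
  alternative is stated modulo finite sets because the fusion is only almost contained in the
  stages.\<close>

lemma thinning_step:
  assumes q: "positive q" and K: "finite K" "\<And>k. k \<in> K \<Longrightarrow> infinite (q `` {k})"
  obtains q' where "positive q'" and "q' \<subseteq> q" and "\<forall>k\<in>K. infinite (q' `` {k})"
    and "(\<exists>c. F q' c \<and> c \<inter> {..<n} \<times> {..<n} = s \<and> (\<forall>k<n. (c \<inter> q') `` {k} = {})) \<or>
      (\<forall>r c. positive r \<longrightarrow> finite (r - q') \<longrightarrow> F r c \<longrightarrow> c \<inter> {..<n} \<times> {..<n} = s \<longrightarrow> infinite (c - q'))"
proof (cases "\<exists>r c. positive r \<and> r \<subseteq> q \<and> F r c \<and> c \<inter> {..<n} \<times> {..<n} = s \<and>
    (\<forall>k\<in>K. infinite (q `` {k} - c `` {k}))")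
  case True
  then obtain r c where r: "positive r" "r \<subseteq> q" "F r c" "c \<inter> {..<n} \<times> {..<n} = s"
    and c: "\<And>k. k \<in> K \<Longrightarrow> infinite (q `` {k} - c `` {k})"
    by blast
  \<comment> \<open>In the columns of \<open>K\<close>, remove \<open>c\<close> from
    \<open>q\<close>; elsewhere follow \<open>r\<close>, dropping the columns below
    \<open>n\<close>. Thus \<open>c\<close> misses \<open>q'\<close> below \<open>n\<close>, while
    \<open>q'\<close> leaves \<open>r\<close> only in finitely many columns.\<close>
  define q' where "q' = {(k, m) \<in> q - c. k \<in> K} \<union> {(k, m) \<in> r. k \<notin> K \<and> n \<le> k}"
  have "fst ` (r - {(k, m) \<in> r. k \<notin> K \<and> n \<le> k}) \<subseteq> K \<union> {..<n}"
    by auto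
  then have "finite (fst ` (r - {(k, m) \<in> r. k \<notin> K \<and> n \<le> k}))"
    by (rule finite_subset) (use K in simp)
  then have "positive (r \<inter> {(k, m) \<in> r. k \<notin> K \<and> n \<le> k})"
    by (rule positive_remove_columns[OF r(1)])
  then have q': "positive q'"
    by (rule positive_mono) (auto simp: q'_def)
  show ?thesis
  proof (rule that[OF q'])
    show "q' \<subseteq> q"
      using r(2) by (auto simp: q'_def)
    have "q `` {k} - c `` {k} \<subseteq> q' `` {k}" if "k \<in> K" for k
      using that by (auto simp: q'_def)
    then show "\<forall>k\<in>K. infinite (q' `` {k})"
      using c by (auto dest: finite_subset)
    have "fst ` (q' - r) \<subseteq> K"
      by (auto simp: q'_def)
    then have "F q' c"
      by (intro F_almost[OF r(3,1) q'] finite_subset[OF _ K(1)])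
    moreover have "(c \<inter> q') `` {k} = {}" if "k < n" for k
      using that by (auto simp: q'_def)
    ultimately show "(\<exists>c. F q' c \<and> c \<inter> {..<n} \<times> {..<n} = s \<and> (\<forall>k<n. (c \<inter> q') `` {k} = {})) \<or>
      (\<forall>r c. positive r \<longrightarrow> finite (r - q') \<longrightarrow> F r c \<longrightarrow> c \<inter> {..<n} \<times> {..<n} = s \<longrightarrow> infinite (c - q'))"
      using r(4) by blast
  qed
next
  case False
  \<comment> \<open>Now every candidate \<open>c\<close> contains almost all of some column in
    \<open>K\<close>. Keeping only half of each such column makes \<open>c\<close> meet a discarded
    half in an infinite set.\<close>
  have "\<exists>H. k \<in> K \<longrightarrow> H \<subseteq> q `` {k} \<and> infinite H \<and> infinite (q `` {k} - H)" for k
  proof (cases "k \<in> K")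
    case True
    from infinite_split[OF K(2)[OF this]] obtain A B where
      AB: "A \<subseteq> q `` {k}" "B \<subseteq> q `` {k}" "infinite A" "infinite B" "A \<inter> B = {}" .
    then have "B \<subseteq> q `` {k} - A"
      by blast
    then have "infinite (q `` {k} - A)"
      using AB(4) by (rule infinite_super)
    then show ?thesis
      using AB(1,3) by blast
  qed simp
  then obtain H where H: "\<And>k. k \<in> K \<Longrightarrow> H k \<subseteq> q `` {k}" "\<And>k. k \<in> K \<Longrightarrow> infinite (H k)"
    "\<And>k. k \<in> K \<Longrightarrow> infinite (q `` {k} - H k)"
    by metis
  define q' where "q' = {(k, m) \<in> q. k \<in> K \<longrightarrow> m \<in> H k}"
  have sub: "q' \<subseteq> q"
    by (auto simp: q'_def)
  have "fst ` (q - q') \<subseteq> K"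
    by (auto simp: q'_def)
  then have "positive (q \<inter> q')"
    by (intro positive_remove_columns[OF q] finite_subset[OF _ K(1)])
  then have q': "positive q'"
    by (rule positive_mono) simp
  have col: "q' `` {k} = H k" if "k \<in> K" for k
    using H(1)[OF that] that by (auto simp: q'_def)
  show ?thesis
  proof (rule that[OF q' sub])
    show "\<forall>k\<in>K. infinite (q' `` {k})"
      using H(2) col by simp
    have "infinite (c - q')"
      if r: "positive r" "finite (r - q')" "F r c" "c \<inter> {..<n} \<times> {..<n} = s" for r c
    proof -
      have "finite (fst ` (r - q'))"
        using r(2) by simp
      \<comment> \<open>The set \<open>r\<close> is only almost contained in \<open>q'\<close>; the
        intersection is contained in \<open>q\<close>, as the failed case requires, and
        \<open>F\<close> carries over to it.\<close>
      then have pos: "positive (r \<inter> q')"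
        by (rule positive_remove_columns[OF r(1)])
      have "finite (fst ` (r \<inter> q' - r))"
        by (rule finite_subset[of _ "{}"]) auto
      then have "F (r \<inter> q') c"
        by (rule F_almost[OF r(3,1) pos])
      moreover have "r \<inter> q' \<subseteq> q"
        using sub by blast
      ultimately obtain k where k: "k \<in> K" "finite (q `` {k} - c `` {k})"
        using False pos r(4) by blast
      have "q `` {k} - H k \<subseteq> (q `` {k} - c `` {k}) \<union> (c - q') `` {k}"
        using col[OF k(1)] by blast
      then have "infinite ((c - q') `` {k})"
        using H(3)[OF k(1)] finite_subset finite_UnI[OF k(2)] by blast
      then show ?thesis
        using finite_Image[of "c - q'" "{k}"] by blast
    qed
    then show "(\<exists>c. F q' c \<and> c \<inter> {..<n} \<times> {..<n} = s \<and> (\<forall>k<n. (c \<inter> q') `` {k} = {})) \<or>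
      (\<forall>r c. positive r \<longrightarrow> finite (r - q') \<longrightarrow> F r c \<longrightarrow> c \<inter> {..<n} \<times> {..<n} = s \<longrightarrow> infinite (c - q'))"
      by blast
  qed
qed

text \<open>At stage \<open>l\<close> one point is taken from \<open>q l\<close> in each of the
  finitely many columns of \<open>K l\<close>. Only the points taken before stage \<open>j\<close>
  can lie outside \<open>q j\<close>.\<close>

lemma fusion:
  fixes q :: "nat \<Rightarrow> (nat \<times> nat) set"
  assumes q: "\<And>j. q (Suc j) \<subseteq> q j" and K: "\<And>j. finite (K j)" "\<And>j. K j \<subset> K (Suc j)"
    and qK: "\<And>j k. k \<in> K j \<Longrightarrow> infinite (q j `` {k})"
  obtains d where "positive d" and "d \<subseteq> q 0" and "\<forall>j. finite (d - q j)"
proof -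
  have anti: "q j \<subseteq> q i" if "i \<le> j" for i j
    using lift_Suc_antimono_le[of q, OF q that] .
  have mono: "K i \<subseteq> K j" if "i \<le> j" for i j
    using lift_Suc_mono_le[of K, OF psubset_imp_subset[OF K(2)] that] .
  \<comment> \<open>The bound \<open>l \<le> m\<close> makes the points chosen in a column at
    successive stages unbounded, so the column becomes infinite.\<close>
  have "\<exists>m. k \<in> K l \<longrightarrow> l \<le> m \<and> (k, m) \<in> q l" for k l
    using qK[of k l] unfolding infinite_nat_iff_unbounded_le by blast
  then obtain x where x: "\<And>k l. k \<in> K l \<Longrightarrow> l \<le> x k l \<and> (k, x k l) \<in> q l"
    by metis
  define d where "d = {(k, x k l) | k l. k \<in> K l}"
  have "infinite (d `` {k})" if "k \<in> K j" for j k
    unfolding infinite_nat_iff_unbounded_le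
  proof
    fix m
    have "k \<in> K (max j m)"
      using that mono[of j "max j m"] by auto
    then show "\<exists>n\<ge>m. n \<in> d `` {k}"
      using x[of k "max j m"] by (intro exI[of _ "x k (max j m)"]) (auto simp: d_def)
  qed
  then have sub: "(\<Union>j. K j) \<subseteq> {k. infinite (d `` {k})}"
    by blast
  \<comment> \<open>Strict growth of the \<open>K j\<close> supplies infinitely many promised
    columns.\<close>
  have "j \<le> card (K j)" for j
  proof (induction j)
    case (Suc j)
    then show ?case
      using psubset_card_mono[OF K(1) K(2)[of j]] by simp
  qed simp
  then have "infinite (\<Union>j. K j)"
    by (metis UNIV_I UN_upper card_mono not_less_eq_eq order_trans)
  then have "positive d"
    unfolding positive_def using sub infinite_super by blast
  moreover have "d \<subseteq> q 0"
    using x anti unfolding d_def by blast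
  moreover have "finite (d - q j)" for j
  proof (rule finite_subset)
    show "d - q j \<subseteq> (\<Union>l<j. (\<lambda>k. (k, x k l)) ` K l)"
    proof
      fix z assume z: "z \<in> d - q j"
      then obtain k l where l: "z = (k, x k l)" "k \<in> K l"
        unfolding d_def by blast
      then have "\<not> j \<le> l"
        using z x anti by blast
      then show "z \<in> (\<Union>l<j. (\<lambda>k. (k, x k l)) ` K l)"
        using l by auto
    qed
    show "finite (\<Union>l<j. (\<lambda>k. (k, x k l)) ` K l)"
      using K(1) by simp
  qed
  ultimately show ?thesis
    using that by blast
qed

lemma convergent_sequence_exists:
  assumes p: "positive p"
    and base: "\<And>q. positive q \<Longrightarrow> q \<subseteq> p \<Longrightarrow> \<exists>r c. positive r \<and> r \<subseteq> q \<and> c \<subseteq> q \<and> F r c"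
  obtains r b c where "positive r" and "r \<subseteq> p" and "F r b" and "\<forall>n. F r (c n)"
    and "\<forall>n. c n \<inter> {..<n} \<times> {..<n} = b \<inter> {..<n} \<times> {..<n}"
    and "\<forall>n. \<forall>k<n. finite ((c n \<inter> r) `` {k})"
proof -
  \<comment> \<open>All requirements: a possible finite trace together with the side length of the
    square. Every trace is listed in advance because \<open>b\<close> is found only after the
    fusion.\<close>
  define T where "T = (Collect finite :: (nat \<times> nat) set set) \<times> (UNIV :: nat set)"
  have T: "countable T" "T \<noteq> {}"
    unfolding T_def by (auto intro!: countable_SIGMA countable_Collect_finite)
  define t where "t = from_nat_into T"
  define hit where "hit q s n \<longleftrightarrow> (\<exists>c. F q c \<and> c \<inter> {..<n} \<times> {..<n} = s \<and> (\<forall>k<n. (c \<inter> q) `` {k} = {}))"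
    for q s n
  define miss where "miss q s n \<longleftrightarrow>
    (\<forall>r c. positive r \<longrightarrow> finite (r - q) \<longrightarrow> F r c \<longrightarrow> c \<inter> {..<n} \<times> {..<n} = s \<longrightarrow> infinite (c - q))"
    for q s n
  \<comment> \<open>A stage is a pair: the current positive set and the finite set of columns
    promised to stay infinite.\<close>
  define P where "P x \<longleftrightarrow> positive (fst x) \<and> fst x \<subseteq> p \<and> finite (snd x) \<and> (\<forall>k\<in>snd x. infinite (fst x `` {k}))"
    for x :: "(nat \<times> nat) set \<times> nat set"
  define Q where "Q j x y \<longleftrightarrow> fst y \<subseteq> fst x \<and> snd x \<subset> snd y \<and>
      (hit (fst y) (fst (t j)) (snd (t j)) \<or> miss (fst y) (fst (t j)) (snd (t j)))"
    for j and x y :: "(nat \<times> nat) set \<times> nat set"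
  have "\<exists>f. \<forall>j. P (f j) \<and> Q j (f j) (f (Suc j))"
  proof (rule dependent_nat_choice)
    show "\<exists>x. P x"
      using p unfolding P_def by (intro exI[of _ "(p, {})"]) simp
  next
    fix x j assume "P x"
    then have x: "positive (fst x)" "finite (snd x)" "\<And>k. k \<in> snd x \<Longrightarrow> infinite (fst x `` {k})" "fst x \<subseteq> p"
      by (auto simp: P_def)
    obtain q where q: "positive q" "q \<subseteq> fst x" "\<forall>k\<in>snd x. infinite (q `` {k})"
      "hit q (fst (t j)) (snd (t j)) \<or> miss q (fst (t j)) (snd (t j))"
      unfolding hit_def miss_def by (rule thinning_step[OF x(1-3), of "snd (t j)" "fst (t j)"])
    \<comment> \<open>A positive set has an infinite column not yet promised; adding it makes the
      promises grow strictly.\<close>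
    have "\<not> {k. infinite (q `` {k})} \<subseteq> snd x"
      using q(1) x(2) finite_subset unfolding positive_def by blast
    then obtain k where k: "infinite (q `` {k})" "k \<notin> snd x"
      by blast
    have "P (q, insert k (snd x))"
      using q(1-3) x(2,4) k(1) by (auto simp: P_def)
    moreover have "Q j x (q, insert k (snd x))"
      using q(2,4) k(2) by (auto simp: Q_def)
    ultimately show "\<exists>y. P y \<and> Q j x y"
      by blast
  qed
  then obtain f where f: "\<And>j. P (f j)" "\<And>j. Q j (f j) (f (Suc j))"
    by blast
  obtain d where d: "positive d" "d \<subseteq> fst (f 0)" "\<forall>j. finite (d - fst (f j))"
  proof (rule fusion[of "\<lambda>j. fst (f j)" "\<lambda>j. snd (f j)"])
    show "fst (f (Suc j)) \<subseteq> fst (f j)" "snd (f j) \<subset> snd (f (Suc j))" for j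
      using f(2)[of j] by (auto simp: Q_def)
    show "finite (snd (f j))" "k \<in> snd (f j) \<Longrightarrow> infinite (fst (f j) `` {k})" for j k
      using f(1)[of j] by (auto simp: P_def)
  qed
  have "d \<subseteq> p"
    using d(2) f(1)[of 0] by (auto simp: P_def)
  \<comment> \<open>The base property is applied to the fusion itself, which gives
    \<open>b \<subseteq> d\<close>.\<close>
  with base[OF d(1)] obtain r b where r: "positive r" "r \<subseteq> d" "b \<subseteq> d" "F r b"
    by blast
  have "\<exists>c. F r c \<and> c \<inter> {..<n} \<times> {..<n} = b \<inter> {..<n} \<times> {..<n} \<and> (\<forall>k<n. finite ((c \<inter> r) `` {k}))" for n
  proof -
    have "(b \<inter> {..<n} \<times> {..<n}, n) \<in> T"
      by (simp add: T_def)
    then obtain j where j: "t j = (b \<inter> {..<n} \<times> {..<n}, n)"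
      using from_nat_into_surj[OF T(1)] unfolding t_def by metis
    \<comment> \<open>Requirement \<open>t j\<close> is met in passing from stage \<open>j\<close>
      to stage \<open>Suc j\<close>.\<close>
    define q where "q = fst (f (Suc j))"
    have q: "positive q"
      using f(1)[of "Suc j"] by (simp add: q_def P_def)
    have "finite (d - q)"
      using d(3) by (simp add: q_def)
    then have fin: "finite (r - q)" "finite (b - q)"
      using r(2,3) by (auto elim: rev_finite_subset)
    \<comment> \<open>Here \<open>r\<close> and \<open>b\<close> themselves refute the second
      alternative: \<open>b\<close> has the required trace and is almost contained in
      \<open>q\<close>.\<close>
    then have "\<not> miss q (b \<inter> {..<n} \<times> {..<n}) n"
      using r unfolding miss_def by blast
    then have "hit q (b \<inter> {..<n} \<times> {..<n}) n"
      using f(2)[of j] by (simp add: Q_def j q_def)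
    then obtain c where c: "F q c" "c \<inter> {..<n} \<times> {..<n} = b \<inter> {..<n} \<times> {..<n}"
      "\<And>k. k < n \<Longrightarrow> (c \<inter> q) `` {k} = {}"
      unfolding hit_def by blast
    have "F r c"
      by (rule F_almost[OF c(1) q r(1)]) (use fin(1) in simp)
    moreover have "finite ((c \<inter> r) `` {k})" if "k < n" for k
    proof (rule finite_subset)
      show "(c \<inter> r) `` {k} \<subseteq> (r - q) `` {k}"
        using c(3)[OF that] by blast
      show "finite ((r - q) `` {k})"
        using fin(1) by (rule finite_Image)
    qed
    ultimately show ?thesis
      using c(2) by blast
  qed
  then obtain c where c: "\<And>n. F r (c n) \<and> c n \<inter> {..<n} \<times> {..<n} = b \<inter> {..<n} \<times> {..<n} \<and>
      (\<forall>k<n. finite ((c n \<inter> r) `` {k}))"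
    by moura
  show ?thesis
  proof (rule that[OF r(1) _ r(4)])
    show "r \<subseteq> p"
      using r(2) \<open>d \<subseteq> p\<close> by simp
  qed (use c in auto)
qed

end



section \<open>The generic ultrafilter\<close>

lemma fSubset_cong_left:
  assumes "(a \<^bold>= a') p" and "(a \<^bold>\<subseteq> b) p"
  shows "(a' \<^bold>\<subseteq> b) p"
  unfolding fSubset_iff
proof (intro allI impI)
  fix x q assume q: "q \<le> p" and x: "(x \<^bold>\<in> a') q"
  have "(x \<^bold>\<in> a) q"
    by (rule fMem_cong_right[OF fEq_sym[OF fEq_mono[OF assms(1) q]] x])
  then show "(x \<^bold>\<in> b) q"
    using assms(2) q unfolding fSubset_iff by simp
qed

context
  assumes inf: "infinite (UNIV :: 'k set)"
begin

section \<open>Open sets and convergence in the forcing language\<close>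

lemma fOpenD:
  fixes S W :: "('k, 'p::order_top) name"
  assumes "fOpen S W p" and "(a \<^bold>\<in> W) p"
  obtains r F where "r \<le> p" and "(F \<^bold>\<subseteq> S) r" and "fFinite F r"
    and "\<And>c s. s \<le> r \<Longrightarrow> (c \<^bold>\<subseteq> S) s \<Longrightarrow>
      (\<And>x t. t \<le> s \<Longrightarrow> (x \<^bold>\<in> F) t \<Longrightarrow> (x \<^bold>\<in> c) t \<longleftrightarrow> (x \<^bold>\<in> a) t) \<Longrightarrow> (c \<^bold>\<in> W) s"
proof -
  have "\<forall>a. \<forall>q\<le>p. (a \<^bold>\<in> W) q \<longrightarrow> dense_below q (\<lambda>r. \<exists>F. (F \<^bold>\<subseteq> S) r \<and> fFinite F r \<and>
      (\<forall>c. \<forall>s\<le>r. (c \<^bold>\<subseteq> S) s \<and> (\<forall>x. \<forall>t\<le>s. (x \<^bold>\<in> F) t \<longrightarrow> (\<forall>u\<le>t. (x \<^bold>\<in> c) u \<longleftrightarrow> (x \<^bold>\<in> a) u)) \<longrightarrow>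
        (c \<^bold>\<in> W) s))"
    using assms(1) unfolding fOpen_def by (simp add: forcing_iffs regular_formulas)
  then have "dense_below p (\<lambda>r. \<exists>F. (F \<^bold>\<subseteq> S) r \<and> fFinite F r \<and>
      (\<forall>c. \<forall>s\<le>r. (c \<^bold>\<subseteq> S) s \<and> (\<forall>x. \<forall>t\<le>s. (x \<^bold>\<in> F) t \<longrightarrow> (\<forall>u\<le>t. (x \<^bold>\<in> c) u \<longleftrightarrow> (x \<^bold>\<in> a) u)) \<longrightarrow>
        (c \<^bold>\<in> W) s))"
    using assms(2) by simp
  then obtain r F where r: "r \<le> p" "(F \<^bold>\<subseteq> S) r" "fFinite F r"
    and F: "\<And>c s. s \<le> r \<Longrightarrow> (c \<^bold>\<subseteq> S) s \<Longrightarrow>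
      \<forall>x. \<forall>t\<le>s. (x \<^bold>\<in> F) t \<longrightarrow> (\<forall>u\<le>t. (x \<^bold>\<in> c) u \<longleftrightarrow> (x \<^bold>\<in> a) u) \<Longrightarrow> (c \<^bold>\<in> W) s"
    by (elim dense_belowE[OF _ order_refl]) auto
  show ?thesis
  proof (rule that[OF r])
    fix c s
    assume s: "s \<le> r" "(c \<^bold>\<subseteq> S) s"
      and agree: "\<And>x t. t \<le> s \<Longrightarrow> (x \<^bold>\<in> F) t \<Longrightarrow> (x \<^bold>\<in> c) t \<longleftrightarrow> (x \<^bold>\<in> a) t"
    have "(x \<^bold>\<in> c) u \<longleftrightarrow> (x \<^bold>\<in> a) u" if "t \<le> s" "(x \<^bold>\<in> F) t" "u \<le> t" for x t u
      using agree[of u x] fMem_mono[OF that(2,3)] that(1,3) by auto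
    then show "(c \<^bold>\<in> W) s"
      by (intro F[OF s]) blast
  qed
qed

text \<open>Any name for an index is densely decided to be a numeral, and membership in
  \<open>W\<close> is regular; so an actual number \<open>m\<close> can serve as threshold and only
  numerals need testing.\<close>

lemma fConvergesI:
  fixes S f b :: "('k, 'p::order_top) name"
  assumes "\<And>W q. q \<le> p \<Longrightarrow> fOpen S W q \<Longrightarrow> (b \<^bold>\<in> W) q \<Longrightarrow> \<exists>r\<le>q. \<exists>m. \<forall>n\<ge>m. \<forall>x. \<forall>s\<le>r.
    (opair_name (nat_name n) x \<^bold>\<in> f) s \<longrightarrow> (x \<^bold>\<in> W) s"
  shows "fConverges S f b p"
proof -
  have "dense_below q (\<lambda>r. \<exists>m. (m \<^bold>\<in> omega_name) r \<and> (\<forall>n. \<forall>s\<le>r. (n \<^bold>\<in> omega_name) s \<longrightarrow>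
      (\<forall>t\<le>s. dense_below t (\<lambda>u. (m \<^bold>= n) u \<or> (m \<^bold>\<in> n) u) \<longrightarrow>
        (\<forall>x. \<forall>u\<le>t. (opair_name n x \<^bold>\<in> f) u \<longrightarrow> (x \<^bold>\<in> W) u))))"
    if q: "q \<le> p" "fOpen S W q \<and> (b \<^bold>\<in> W) q" for W q
  proof (rule dense_belowI)
    fix q' assume q': "q' \<le> q"
    have "q' \<le> p" "fOpen S W q'" "(b \<^bold>\<in> W) q'"
      using q q' regular_mono[OF regular_fOpen] fMem_mono by auto
    then obtain r m where r: "r \<le> q'"
      and m: "\<forall>n\<ge>m. \<forall>x. \<forall>s\<le>r. (opair_name (nat_name n) x \<^bold>\<in> f) s \<longrightarrow> (x \<^bold>\<in> W) s"
      using assms[of q' W] by blast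
    have "(x \<^bold>\<in> W) u" if n: "s \<le> r" "(n \<^bold>\<in> omega_name) s" "t \<le> s"
      "dense_below t (\<lambda>u. (nat_name m \<^bold>= n) u \<or> (nat_name m \<^bold>\<in> n) u)" "u \<le> t" "(opair_name n x \<^bold>\<in> f) u"
      for n x s t u
    proof (rule regularI_dense[OF regular_fMem])
      fix v assume v: "v \<le> u"
      then have "v \<le> t" "v \<le> s" using n by auto
      then obtain v' where v': "v' \<le> v" "(nat_name m \<^bold>= n) v' \<or> (nat_name m \<^bold>\<in> n) v'"
        using dense_belowE[OF n(4)] by blast
      have "v' \<le> s" using v'(1) \<open>v \<le> s\<close> by simp
      then obtain w where "w \<le> v'" "\<exists>j\<in>UNIV. (n \<^bold>= nat_name j) w"
        using dense_belowE[OF n(2)[unfolded fMem_omega_name_iff[OF inf]]] by blast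
      then obtain j where w: "w \<le> v'" "(n \<^bold>= nat_name j) w"
        by blast
      have "(nat_name m \<^bold>= n) w \<or> (nat_name m \<^bold>\<in> n) w"
        using v'(2) w(1) fEq_mono fMem_mono by blast
      then have "(nat_name m \<^bold>= (nat_name j :: ('k, 'p) name)) w \<or> (nat_name m \<^bold>\<in> (nat_name j :: ('k, 'p) name)) w"
        using fEq_trans[OF _ w(2)] fMem_cong_right[OF w(2)] by blast
      then have "m \<le> j"
        by (auto simp: nat_name_eq_iff[OF inf] nat_name_mem_iff[OF inf])
      moreover have "w \<le> r" "w \<le> u"
        using w(1) v'(1) v n by auto
      moreover have "(opair_name (nat_name j) x \<^bold>\<in> f) w"
        by (rule fMem_cong_left[OF opair_name_cong[OF inf w(2) fEq_refl] fMem_mono[OF n(6) \<open>w \<le> u\<close>]])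
      ultimately have "(x \<^bold>\<in> W) w"
        using m by simp
      moreover have "w \<le> v" using w(1) v'(1) by simp
      ultimately show "\<exists>w\<le>v. (x \<^bold>\<in> W) w"
        by blast
    qed
    then show "\<exists>r\<le>q'. \<exists>m. (m \<^bold>\<in> omega_name) r \<and> (\<forall>n. \<forall>s\<le>r. (n \<^bold>\<in> omega_name) s \<longrightarrow>
      (\<forall>t\<le>s. dense_below t (\<lambda>u. (m \<^bold>= n) u \<or> (m \<^bold>\<in> n) u) \<longrightarrow>
        (\<forall>x. \<forall>u\<le>t. (opair_name n x \<^bold>\<in> f) u \<longrightarrow> (x \<^bold>\<in> W) u)))"
      using r nat_name_mem_omega[OF inf] by blast
  qed
  then show ?thesis
    unfolding fConverges_def by (simp add: forcing_iffs regular_formulas fMapsto_iff[OF inf])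
qed

lemma check_name_subset_iff:
  fixes p :: "'p::order_top"
  shows "(check_name A \<^bold>\<subseteq> (check_name B :: ('k, 'p) name)) p \<longleftrightarrow> A \<subseteq> B"
proof
  assume sub: "(check_name A \<^bold>\<subseteq> (check_name B :: ('k, 'p) name)) p"
  show "A \<subseteq> B"
  proof
    fix z assume "z \<in> A"
    then have "(pair_name z \<^bold>\<in> (check_name A :: ('k, 'p) name)) p"
      by (simp add: pair_name_mem_check_iff[OF inf])
    then have "(pair_name z \<^bold>\<in> (check_name B :: ('k, 'p) name)) p"
      using sub unfolding fSubset_iff by simp
    then show "z \<in> B"
      by (simp add: pair_name_mem_check_iff[OF inf])
  qed
next
  assume "A \<subseteq> B"
  then show "(check_name A \<^bold>\<subseteq> (check_name B :: ('k, 'p) name)) p"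
    unfolding fSubset_iff fMem_check_name_iff[OF inf] by (blast intro: dense_below_mono)
qed

text \<open>The finite set \<open>F\<close> describing a neighbourhood is covered by a finite ground
  model set \<open>A\<close>. Once the square of side \<open>n\<close> contains \<open>A\<close>,
  \<open>c n\<close> and \<open>b\<close> agree on \<open>F\<close>.\<close>

lemma fConverges_seq_name:
  fixes p :: "'p::order_top"
  assumes c: "\<And>n. c n \<inter> {..<n} \<times> {..<n} = b \<inter> {..<n} \<times> {..<n}"
  shows "fConverges (check_name UNIV :: ('k, 'p) name) (seq_name UNIV (\<lambda>n. check_name (c n))) (check_name b) p"
proof (rule fConvergesI)
  fix W :: "('k, 'p) name" and q
  assume "fOpen (check_name UNIV) W q" "(check_name b \<^bold>\<in> W) q"
  then obtain r F where r: "r \<le> q" "(F \<^bold>\<subseteq> check_name UNIV) r" "fFinite F r"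
    and F: "\<And>c s. s \<le> r \<Longrightarrow> (c \<^bold>\<subseteq> check_name UNIV) s \<Longrightarrow>
      (\<And>x t. t \<le> s \<Longrightarrow> (x \<^bold>\<in> F) t \<Longrightarrow> (x \<^bold>\<in> c) t \<longleftrightarrow> (x \<^bold>\<in> check_name b) t) \<Longrightarrow> (c \<^bold>\<in> W) s"
    by (rule fOpenD) (use that in blast)
  obtain s A where s: "s \<le> r" "finite A" "(F \<^bold>\<subseteq> check_name A) s"
    using finite_cover_if_fFinite[OF inf r(2,3)] by blast
  obtain m where m: "A \<subseteq> {..<m} \<times> {..<m}"
  proof
    \<comment> \<open>\<open>Suc\<close> because the square is open at its upper end; for empty
      \<open>A\<close> any square will do.\<close>
    show "A \<subseteq> {..<Suc (Max (fst ` A \<union> snd ` A))} \<times> {..<Suc (Max (fst ` A \<union> snd ` A))}"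
      using s(2) by (force simp: less_Suc_eq_le intro!: Max_ge)
  qed
  have "(x \<^bold>\<in> W) t" if "m \<le> n" "t \<le> s" "(opair_name (nat_name n) x \<^bold>\<in> seq_name UNIV (\<lambda>n. check_name (c n))) t"
    for n x t
  proof (rule fMem_cong_left)
    show "(check_name (c n) \<^bold>= x) t"
      by (rule fEq_sym[OF opair_nat_name_mem_seq_nameD[OF inf that(3) fEq_refl]])
    show "(check_name (c n) \<^bold>\<in> W) t"
    proof (rule F)
      show "t \<le> r" using that(2) s(1) by simp
      show "(check_name (c n) \<^bold>\<subseteq> (check_name UNIV :: ('k, 'p) name)) t"
        by (simp add: check_name_subset_iff)
      fix x u assume u: "u \<le> t" "(x \<^bold>\<in> F) u"
      have "u \<le> s" using u(1) that(2) by simp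
      then have x: "(x \<^bold>\<in> check_name A) u"
        using s(3) u(2) unfolding fSubset_iff by blast
      have sub: "A \<subseteq> {..<n} \<times> {..<n}"
        using m that(1) by fastforce
      have agree: "z \<in> c n \<longleftrightarrow> z \<in> b" if "z \<in> A" for z
        using c[of n] sub that by blast
      \<comment> \<open>A name in \<open>F\<close> is densely decided to be some pair in
        \<open>A\<close>, where the two ground model sets can be compared directly.\<close>
      have transfer: "(x \<^bold>\<in> check_name E') u" if "(x \<^bold>\<in> check_name E) u" "\<And>z. z \<in> A \<Longrightarrow> z \<in> E \<Longrightarrow> z \<in> E'"
        for E E' :: "(nat \<times> nat) set"
      proof (rule regularI_dense[OF regular_fMem])
        fix v assume "v \<le> u"
        then obtain w where w: "w \<le> v" "\<exists>z\<in>A. (x \<^bold>= pair_name z) w"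
          using dense_belowE[OF x[unfolded fMem_check_name_iff[OF inf]]] by blast
        then obtain z where z: "z \<in> A" "(x \<^bold>= pair_name z) w"
          by blast
        have "w \<le> u" using w(1) \<open>v \<le> u\<close> by simp
        then have "z \<in> E"
          using fMem_cong_left[OF z(2) fMem_mono[OF that(1)]] by (simp add: pair_name_mem_check_iff[OF inf])
        then have "(pair_name z \<^bold>\<in> (check_name E' :: ('k, 'p) name)) w"
          using that(2)[OF z(1)] by (simp add: pair_name_mem_check_iff[OF inf])
        then have "(x \<^bold>\<in> check_name E') w"
          by (rule fMem_cong_left[OF fEq_sym[OF z(2)]])
        then show "\<exists>w\<le>v. (x \<^bold>\<in> check_name E') w"
          using w(1) by blast
      qed
      show "(x \<^bold>\<in> check_name (c n)) u \<longleftrightarrow> (x \<^bold>\<in> check_name b) u"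
        using transfer[of "c n" b] transfer[of b "c n"] agree by blast
    qed
  qed
  moreover have "s \<le> q" using s(1) r(1) by simp
  ultimately show "\<exists>r\<le>q. \<exists>m. \<forall>n\<ge>m. \<forall>x. \<forall>s\<le>r.
      (opair_name (nat_name n) x \<^bold>\<in> seq_name UNIV (\<lambda>n. check_name (c n))) s \<longrightarrow> (x \<^bold>\<in> W) s"
    by blast
qed

lemma fIsInter_seq_nameD:
  fixes C :: "('k, 'p::order_top) name"
  assumes "fIsInter C (seq_name UNIV y) X p" and "(nat_name n \<^bold>\<in> X) p"
  shows "(C \<^bold>\<subseteq> y n) p"
proof -
  have inter: "(n \<^bold>\<in> X) r \<Longrightarrow> (opair_name n a \<^bold>\<in> seq_name UNIV y) s \<Longrightarrow> (x \<^bold>\<in> a) s"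
    if "(x \<^bold>\<in> C) q" "q \<le> p" "r \<le> q" "s \<le> r" for x q n r a s
    using assms(1) that unfolding fIsInter_def
    by (simp add: forcing_iffs regular_formulas fMapsto_iff[OF inf])
  have "(opair_name (nat_name n) (y n) \<^bold>\<in> seq_name UNIV y) q" for q
    by (rule opair_name_mem_seq_nameI[OF inf, of n]) auto
  then show ?thesis
    unfolding fSubset_iff using inter[OF _ _ order_refl order_refl] fMem_mono[OF assms(2)] by blast
qed

end

section \<open>Conditions as positive sets, and the name of the generic ultrafilter\<close>

lemma positive_cond_set: "positive (cond_set p)"
proof -
  have "cond_set p `` {n} = {m. (n, m) \<in> cond_set p}" for n
    by blast
  then show ?thesis
    using cond_set[of p] by (simp add: positive_def)
qed

lemma cond_set_Cond: "positive q \<Longrightarrow> cond_set (Cond q) = q"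
proof (rule Cond_inverse)
  have "q `` {n} = {m. (n, m) \<in> q}" for n
    by blast
  then show "positive q \<Longrightarrow> q \<in> {p. infinite {n. infinite {m. (n, m) \<in> p}}}"
    by (simp add: positive_def)
qed

text \<open>The final segments of columns are distinct conditions. Through an injection of
  \<open>cond\<close> into \<open>'k\<close>, this makes \<open>'k\<close> infinite.\<close>

lemma infinite_UNIV_cond: "infinite (UNIV :: cond set)"
proof -
  have "positive {(k, m). n \<le> k}" for n
  proof -
    have "positive (UNIV \<inter> {(k, m). n \<le> k})"
    proof (rule positive_remove_columns)
      show "positive UNIV"
        using positive_mono[OF positive_cond_set subset_UNIV] .
      have "fst ` (UNIV - {(k, m). n \<le> k}) \<subseteq> {..<n}"
        by auto
      then show "finite (fst ` (UNIV - {(k, m). n \<le> k}))"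
        by (rule finite_subset) simp
    qed
    then show ?thesis by simp
  qed
  then have "inj (\<lambda>n. Cond {(k, m). n \<le> k})"
    by (intro injI) (metis (mono_tags, lifting) antisym case_prodD case_prodI cond_set_Cond mem_Collect_eq order_refl)
  then show ?thesis
    using finite_imageD[of _ "UNIV :: nat set"] infinite_UNIV_nat finite_subset[OF subset_UNIV] by blast
qed

text \<open>The order on conditions is inclusion, but finitely many columns of a condition never matter.\<close>

lemma regular_almost:
  assumes "regular \<phi>" and "\<phi> q" and "finite (fst ` (cond_set r - cond_set q))"
  shows "\<phi> r"
proof (rule regularI_dense[OF assms(1)])
  fix s assume "s \<le> r"
  then have "fst ` (cond_set s - cond_set q) \<subseteq> fst ` (cond_set r - cond_set q)"
    by (auto simp: less_eq_cond_def)
  then have pos: "positive (cond_set s \<inter> cond_set q)"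
    using assms(3) finite_subset by (intro positive_remove_columns positive_cond_set)
  define t where "t = Cond (cond_set s \<inter> cond_set q)"
  have "t \<le> s" "t \<le> q"
    by (simp_all add: t_def less_eq_cond_def cond_set_Cond[OF pos])
  then show "\<exists>t\<le>s. \<phi> t"
    using regular_mono[OF assms(1,2)] by blast
qed

lemma elts_generic_name:
  fixes e :: "cond \<Rightarrow> 'k"
  assumes "inj e"
  shows "elts (generic_name :: ('k, cond) name) = (\<lambda>p. (check_name (cond_set p), p)) ` UNIV"
  unfolding generic_name_def using assms by (rule elts_mk_name)

text \<open>All names listed in \<open>generic_name\<close> are check names, so an element is
  locally a ground model set. The relation \<open>q \<le> s\<close> records that this set includes
  the condition \<open>q\<close>.\<close>

lemma fMem_generic_nameE:
  fixes e :: "cond \<Rightarrow> 'k" and a :: "('k, cond) name"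
  assumes "inj e" and "(a \<^bold>\<in> generic_name) p"
  obtains q s where "q \<le> p" and "q \<le> s" and "(a \<^bold>= check_name (cond_set s)) q"
  using fMemE[OF assms(2) order_refl] unfolding elts_generic_name[OF assms(1)] by blast

text \<open>\<open>inj e\<close> enters twice: it makes \<open>'k\<close> infinite, so the canonical
  names are correct, and it gives \<open>generic_name\<close> its intended elements.\<close>

theorem theorem60:
  fixes e :: "cond \<Rightarrow> 'k" and p :: cond
  assumes "inj e"
  shows "p \<tturnstile> \<^bold>\<not> fBasicallyGenerated (check_name UNIV :: ('k, cond) name) generic_name"
  unfolding forces_def fNot_iff
proof (intro allI impI notI)
  have inf: "infinite (UNIV :: 'k set)"
    using infinite_UNIV_cond finite_subset[OF subset_UNIV] finite_imageD[OF _ assms] by blast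
  let ?S = "check_name UNIV :: ('k, cond) name" and ?G = "generic_name :: ('k, cond) name"
  fix p0 assume "fBasicallyGenerated ?S ?G p0"
  then have "dense_below p0 (\<lambda>p. \<exists>B. fBase B ?G p \<and> (\<forall>f b. \<forall>q\<le>p. (b \<^bold>\<in> B) q \<longrightarrow>
      (\<forall>r\<le>q. fFunction f omega_name B r \<and> fConverges ?S f b r \<longrightarrow>
        dense_below r (\<lambda>s. \<exists>X. (X \<^bold>\<subseteq> omega_name) s \<and> (\<forall>t\<le>s. \<not> fFinite X t) \<and>
          dense_below s (\<lambda>t. \<exists>C. fIsInter C f X t \<and> (C \<^bold>\<in> ?G) t)))))"
    unfolding fBasicallyGenerated_def by (simp add: forcing_iffs regular_formulas)
  then obtain p B where base: "fBase B ?G p"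
    and generated: "\<And>f b r. r \<le> p \<Longrightarrow> (b \<^bold>\<in> B) r \<Longrightarrow> fFunction f omega_name B r \<Longrightarrow> fConverges ?S f b r \<Longrightarrow>
        dense_below r (\<lambda>s. \<exists>X. (X \<^bold>\<subseteq> omega_name) s \<and> (\<forall>t\<le>s. \<not> fFinite X t) \<and>
          dense_below s (\<lambda>t. \<exists>C. fIsInter C f X t \<and> (C \<^bold>\<in> ?G) t))"
    using dense_belowE[OF _ order_refl] by (smt (verit) order_refl)
  have BG: "(B \<^bold>\<subseteq> ?G) p"
    and refine: "\<And>a q. q \<le> p \<Longrightarrow> (a \<^bold>\<in> ?G) q \<Longrightarrow> dense_below q (\<lambda>r. \<exists>b. (b \<^bold>\<in> B) r \<and> (b \<^bold>\<subseteq> a) r)"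
    using base unfolding fBase_def by (simp_all add: forcing_iffs regular_formulas)
  \<comment> \<open>\<open>Cond q\<close> is meaningful only for positive \<open>q\<close>, and the
    combinatorial lemmas consult \<open>F\<close> only at positive sets.\<close>
  define F where "F q c \<longleftrightarrow> (check_name c \<^bold>\<in> B) (Cond q)" for q c
  obtain r b c where r: "positive r" "r \<subseteq> cond_set p" "F r b" "\<forall>n. F r (c n)"
    "\<forall>n. c n \<inter> {..<n} \<times> {..<n} = b \<inter> {..<n} \<times> {..<n}"
    "\<forall>n. \<forall>k<n. finite ((c n \<inter> r) `` {k})"
  proof (rule convergent_sequence_exists[of F "cond_set p"])
    show "F r c" if "F q c" "positive q" "positive r" "finite (fst ` (r - q))" for q r c
      using that regular_almost[OF regular_fMem, of "check_name c" B "Cond q" "Cond r"]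
      by (simp add: F_def cond_set_Cond)
    show "positive (cond_set p)"
      by (rule positive_cond_set)
    show "\<exists>r c. positive r \<and> r \<subseteq> q \<and> c \<subseteq> q \<and> F r c" if q: "positive q" "q \<subseteq> cond_set p" for q
    proof -
      have "Cond q \<le> p"
        using q by (simp add: less_eq_cond_def cond_set_Cond)
      moreover have "(check_name q, Cond q) \<in> elts ?G"
        unfolding elts_generic_name[OF assms] using cond_set_Cond[OF q(1)] by (intro image_eqI[of _ _ "Cond q"]) auto
      then have "(check_name q \<^bold>\<in> ?G) (Cond q)"
        by (rule elts_imp_fMem) simp
      ultimately have "dense_below (Cond q) (\<lambda>r. \<exists>b. (b \<^bold>\<in> B) r \<and> (b \<^bold>\<subseteq> check_name q) r)"
        by (rule refine)
      then obtain s where "s \<le> Cond q" "\<exists>b. (b \<^bold>\<in> B) s \<and> (b \<^bold>\<subseteq> check_name q) s"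
        by (rule dense_belowE[OF _ order_refl])
      then obtain b where s: "s \<le> Cond q" "(b \<^bold>\<in> B) s" "(b \<^bold>\<subseteq> check_name q) s"
        by blast
      have "s \<le> p"
        using s(1) \<open>Cond q \<le> p\<close> by simp
      then have "(b \<^bold>\<in> ?G) s"
        using BG s(2) unfolding fSubset_iff by blast
      \<comment> \<open>Members of the base lie in the generic ultrafilter, so a stronger condition
        identifies \<open>b\<close> with a ground model set.\<close>
      then obtain t v where t: "t \<le> s" "(b \<^bold>= check_name (cond_set v)) t"
        by (rule fMem_generic_nameE[OF assms])
      have "(check_name (cond_set v) \<^bold>\<subseteq> (check_name q :: ('k, cond) name)) t"
        by (rule fSubset_cong_left[OF t(2) regular_mono[OF regular_fSubset s(3) t(1)]])
      then have "cond_set v \<subseteq> q"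
        by (simp add: check_name_subset_iff[OF inf])
      moreover have "F (cond_set t) (cond_set v)"
        using fMem_cong_left[OF t(2) fMem_mono[OF s(2) t(1)]] by (simp add: F_def cond_set_inverse)
      moreover have "cond_set t \<subseteq> q"
        using t(1) s(1) cond_set_Cond[OF q(1)] by (auto simp: less_eq_cond_def)
      ultimately show ?thesis
        using positive_cond_set by blast
    qed
  qed
  define d where "d = Cond r"
  have d: "cond_set d = r" "d \<le> p"
    using r(1,2) by (simp_all add: d_def less_eq_cond_def cond_set_Cond)
  define f :: "('k, cond) name" where "f = seq_name UNIV (\<lambda>n. check_name (c n))"
  have "fFunction f omega_name B d"
    unfolding f_def by (rule fFunction_seq_name[OF inf elts_omega_name[OF inf]]) (use r(4) in \<open>simp add: F_def d_def\<close>)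
  moreover have "fConverges ?S f (check_name b) d"
    unfolding f_def using r(5) by (intro fConverges_seq_name[OF inf]) blast
  moreover have "(check_name b \<^bold>\<in> B) d"
    using r(3) by (simp add: F_def d_def)
  ultimately have "dense_below d (\<lambda>s. \<exists>X. (X \<^bold>\<subseteq> omega_name) s \<and> (\<forall>t\<le>s. \<not> fFinite X t) \<and>
          dense_below s (\<lambda>t. \<exists>C. fIsInter C f X t \<and> (C \<^bold>\<in> ?G) t))"
    using generated[OF d(2)] by blast
  then obtain s where "s \<le> d" "\<exists>X. (X \<^bold>\<subseteq> omega_name) s \<and> (\<forall>t\<le>s. \<not> fFinite X t) \<and>
          dense_below s (\<lambda>t. \<exists>C. fIsInter C f X t \<and> (C \<^bold>\<in> ?G) t)"
    by (rule dense_belowE[OF _ order_refl])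
  then obtain X where X: "s \<le> d" "(X \<^bold>\<subseteq> omega_name) s" "\<And>t. t \<le> s \<Longrightarrow> \<not> fFinite X t"
    and inter: "dense_below s (\<lambda>t. \<exists>C. fIsInter C f X t \<and> (C \<^bold>\<in> ?G) t)"
    by blast
  from inter obtain t where "t \<le> s" "\<exists>C. fIsInter C f X t \<and> (C \<^bold>\<in> ?G) t"
    by (rule dense_belowE[OF _ order_refl])
  then obtain C where C: "t \<le> s" "fIsInter C f X t" "(C \<^bold>\<in> ?G) t"
    by blast
  obtain u v where u: "u \<le> t" "u \<le> v" "(C \<^bold>= check_name (cond_set v)) u"
    using C(3) by (rule fMem_generic_nameE[OF assms])
  \<comment> \<open>The column is fixed before the index, so that an \<open>n\<close> above it can
    be sought in \<open>X\<close>.\<close>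
  have "{k. infinite (cond_set u `` {k})} \<noteq> {}"
    using positive_cond_set[of u] unfolding positive_def by (rule infinite_imp_nonempty)
  then obtain k where k: "infinite (cond_set u `` {k})"
    by blast
  have us: "u \<le> s" using u(1) C(1) by simp
  \<comment> \<open>Otherwise \<open>X\<close> would be bounded by \<open>k\<close> below
    \<open>u\<close>, and some extension of \<open>u\<close> would force it finite.\<close>
  have "\<exists>n>k. \<exists>w\<le>u. (nat_name n \<^bold>\<in> X) w"
  proof (rule ccontr)
    assume "\<not> ?thesis"
    then have "\<And>n w. w \<le> u \<Longrightarrow> (nat_name n \<^bold>\<in> X) w \<Longrightarrow> n \<le> k"
      by (meson not_le_imp_less)
    then obtain w where "w \<le> u" "fFinite X w"
      using fFinite_if_bounded[OF inf regular_mono[OF regular_fSubset X(2) us]] by blast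
    then show False
      using X(3)[of w] us by auto
  qed
  then obtain n w where n: "k < n" "w \<le> u" "(nat_name n \<^bold>\<in> X) w"
    by blast
  have "w \<le> t" using n(2) u(1) by simp
  then have sub: "(C \<^bold>\<subseteq> check_name (c n)) w"
    using fIsInter_seq_nameD[OF inf regular_mono[OF regular_fIsInter C(2)[unfolded f_def]] n(3)] by simp
  have "z \<in> c n" if "z \<in> cond_set v" for z
  proof -
    have "(pair_name z \<^bold>\<in> (check_name (cond_set v) :: ('k, cond) name)) w"
      using that by (simp add: pair_name_mem_check_iff[OF inf])
    then have "(pair_name z \<^bold>\<in> C) w"
      by (rule fMem_cong_right[OF fEq_sym[OF fEq_mono[OF u(3) n(2)]]])
    then have "(pair_name z \<^bold>\<in> (check_name (c n) :: ('k, cond) name)) w"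
      using sub unfolding fSubset_iff by simp
    then show ?thesis
      by (simp add: pair_name_mem_check_iff[OF inf])
  qed
  then have "cond_set v \<subseteq> c n"
    by blast
  \<comment> \<open>Thus \<open>u\<close> lies inside both \<open>c n\<close> and \<open>r\<close>,
    although its column \<open>k\<close> is infinite and theirs in common is finite.\<close>
  moreover have "cond_set u \<subseteq> cond_set v"
    using u(2) by (simp add: less_eq_cond_def)
  moreover have "cond_set u \<subseteq> r"
    using us X(1) d(1) by (auto simp: less_eq_cond_def)
  ultimately have "cond_set u `` {k} \<subseteq> (c n \<inter> r) `` {k}"
    by blast
  then show False
    using k r(6) n(1) finite_subset by blast
qed

end
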